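(* Let $\mathfrak{P}$ be an infinite set of primes having a density $\kappa\in(0,1]$ in the sense that $\sum_{p\le X,\,p\in\mathfrak{P}}\frac{\log p}{p}=\kappa\log X+O(1)$. For $y\ge2$ put $\mathfrak{P}(y)=\prod_{p<y,\,p\in\mathfrak{P}}p$. Let $N$ be large, and let $z,Z,M_0,M$ be real parameters with $\max(2,z)\le Z\le N$ and $2\le M_0\le M$. Define, for positive integers $m$, $$\rho(m)=\frac{\mathbf{1}_{(m,\mathfrak{P}(z))=1}}{1+\#\{p'\in[z,Z]\cap\mathfrak{P}:\ p'\mid m\}}\in[0,1].$$ Then there exist families of complex numbers $(\alpha_\ell(t))_{\ell\ge1}$ and $(\beta_k(t))_{k\ge1}$, indexed by $t\in[0,1]$, such that $|\alpha_\ell(t)|\le1$, $|\beta_k(t)|\le16\tau_3(k)\log N$, $\alpha_\ell(t)=0$ whenever $\ell\nmid\mathfrak{P}(z)$, and such that for any sequence of complex numbers $(u_n)_{n\le N}$ we have $$\sum_{\substack{n\le N\\(n,\mathfrak{P}(Z))=1}}u_n=\sum_{\substack{d<M\\ d\mid\mathfrak{P}(z)}}\mu(d)\sum_{\substack{n\le N\\ n\equiv0\ (\mathrm{mod}\ d)}}u_n-\sum_{\substack{mp\le N\\ z\le p<Z,\ p\in\mathfrak{P}}}\rho(m)u_{mp}-\int_0^1\sum_{\substack{M\le k\ell\le N\\ M_0\le\ell\le M_0z}}\alpha_\ell(t)\beta_k(t)u_{k\ell}\,dt+O\biggl(\sqrt{\frac{N\sum_{n\le N}|u_n|^2}{z}}\biggr),$$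 with an absolute implied constant. If $|u_n|\le1$ for all $n$, the error term may be replaced by $O(N/z)$.
   Context: $\mu$ is the Möbius function, $\tau_3(k)=\#\{(d_1,d_2,d_3)\in\mathbb{N}^3: d_1d_2d_3=k\}$; $p,p'$ denote primes. *)

theory Defs
  imports "HOL-Analysis.Analysis" "HOL-Library.Landau_Symbols"
    "HOL-Computational_Algebra.Computational_Algebra"
begin

definition moebius_mu :: "nat \<Rightarrow> int" where
  "moebius_mu n = (if squarefree n then (-1) ^ card (prime_factors n) else 0)"

text \<open>For \<open>k \<ge> 1\<close> every \<open>d\<^sub>i\<close> is automatically positive, so this counts triples of
  positive integers. At \<open>k = 0\<close> the set is infinite and the value \<open>0\<close> is meaningless.\<close>
definition tau3 :: "nat \<Rightarrow> nat" where
  "tau3 k = card {(d1, d2, d3). d1 * d2 * d3 = k}"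

definition has_prime_density :: "nat set \<Rightarrow> real \<Rightarrow> bool" where
  "has_prime_density P \<kappa> \<longleftrightarrow>
     (\<lambda>X::real. (\<Sum>p\<in>{p\<in>P. real p \<le> X}. ln (real p) / real p) - \<kappa> * ln X) \<in> O(\<lambda>X. 1)"

definition prime_product :: "nat set \<Rightarrow> real \<Rightarrow> nat" where
  "prime_product P y = \<Prod>{p\<in>P. real p < y}"

definition rho :: "nat set \<Rightarrow> real \<Rightarrow> real \<Rightarrow> nat \<Rightarrow> real" where
  "rho P z Z m = (if coprime m (prime_product P z) then 1 else 0)
     / (1 + real (card {p\<in>P. z \<le> real p \<and> real p \<le> Z \<and> p dvd m}))"

definition bilinear_sum ::
  "nat \<Rightarrow> real \<Rightarrow> real \<Rightarrow> real \<Rightarrow> (nat \<Rightarrow> complex) \<Rightarrow> (nat \<Rightarrow> complex) \<Rightarrow> (nat \<Rightarrow> complex) \<Rightarrow> complex"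
where
  "bilinear_sum N z M0 M a b u =
     (\<Sum>(k, l) \<in> {(k, l). 1 \<le> k \<and> 1 \<le> l \<and> M \<le> real (k * l) \<and> k * l \<le> N
                     \<and> M0 \<le> real l \<and> real l \<le> M0 * z}.
        a l * b k * u (k * l))"

end

theory Submission
  imports Defs "HOL-Library.Discrete_Functions"
begin

text \<open>
  Ramare's identity removes the primes in \<open>[z,Z)\<close>, with an error carried by the few \<open>n\<close> divisible
  by \<open>Z\<close> or by \<open>p\<^sup>2\<close> with \<open>p \<ge> z\<close>. Moebius inversion then leaves the divisors \<open>d \<ge> M\<close> of
  \<open>P(z)\<close>, which have to be written as \<open>d = l * b\<close> with \<open>l \<in> [M0, M0 * z]\<close> and with \<open>l\<close> and \<open>b\<close>
  separated, at the cost of one logarithm only.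

  To this end \<open>l\<close> is chosen at random: the primes of \<open>d\<close> leave independently, \<open>p\<close> at a rate
  comparable to \<open>min (log p) (log M0)\<close>, and \<open>l\<close> is the last product of survivors that is at
  least \<open>M0\<close>. With this rate the survivors of a crossing have total rate between \<open>log M0\<close> and \<open>2 log M0\<close>
  up to constants, so the exit time costs only a bounded factor. At a fixed time, the condition that
  \<open>l\<close> and \<open>b\<close> are coprime factors over the primes; splitting a survival probability \<open>x\<^sup>2\<close> as \<open>x * x\<close>
  leaves one factor \<open>x\<close> to decay in \<open>l\<close> and costs \<open>1 + x \<le> 2\<close> per prime of \<open>b\<close>, whence \<open>\<tau>\<^sub>3\<close>.
  The condition \<open>l * b \<ge> M\<close> is a comparison of two integers with \<open>O(log N)\<close> bits and provides the logarithm.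
  The integral over the exit time is replaced by a Riemann sum, whose error is absorbed in \<open>O(N / z)\<close>.
\<close>

section \<open>Separated kernels\<close>

text \<open>\<open>C\<close> is the total weight of a combination of rank-one kernels \<open>a l * c b\<close>. It becomes
  the length of the interval of integration, hence the loss in the bound for \<open>\<beta>\<close>.\<close>

inductive separable :: "('b \<Rightarrow> real) \<Rightarrow> real \<Rightarrow> ('a \<Rightarrow> 'b \<Rightarrow> real) \<Rightarrow> bool"
  for \<phi> :: "'b \<Rightarrow> real" where
  zero: "separable \<phi> 0 (\<lambda>_ _. 0)"
| add: "separable \<phi> C f \<Longrightarrow> 0 \<le> w \<Longrightarrow> (\<And>l. \<bar>a l\<bar> \<le> 1) \<Longrightarrow> (\<And>b. \<bar>c b\<bar> \<le> \<phi> b) \<Longrightarrow>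
    separable \<phi> (C + w) (\<lambda>l b. f l b + w * (a l * c b))"

lemma separable_nonneg: "separable \<phi> C f \<Longrightarrow> 0 \<le> C"
  by (induction rule: separable.induct) auto

lemma separable_rank_one:
  assumes "\<And>l. \<bar>a l\<bar> \<le> 1" "\<And>b. \<bar>c b\<bar> \<le> \<phi> b"
  shows "separable \<phi> 1 (\<lambda>l b. a l * c b)"
  using separable.add[OF separable.zero, of 1 a c \<phi>] assms by simp

lemma separable_plus:
  assumes "separable \<phi> C f" "separable \<phi> D g"
  shows "separable \<phi> (C + D) (\<lambda>l b. f l b + g l b)"
  using assms(2)
proof (induction rule: separable.induct)
  case zero
  show ?case using assms(1) by simp
next
  case (add D g w a c)
  show ?case using separable.add[OF add.IH add.hyps(2-4)] by (simp add: add.assoc)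
qed

lemma separable_scale:
  assumes "separable \<phi> C f" "0 \<le> r"
  shows "separable \<phi> (r * C) (\<lambda>l b. r * f l b)"
  using assms(1)
proof (induction rule: separable.induct)
  case zero
  show ?case using separable.zero by simp
next
  case (add C f w a c)
  show ?case using separable.add[OF add.IH, of "r * w" a c] add.hyps assms(2)
    by (simp add: algebra_simps)
qed

lemma separable_mult_rank_one:
  assumes "separable \<psi> D g" "\<And>l. \<bar>a l\<bar> \<le> 1" "\<And>b. \<bar>c b\<bar> \<le> \<phi> b"
  shows "separable (\<lambda>b. \<phi> b * \<psi> b) D (\<lambda>l b. a l * c b * g l b)"
  using assms(1)
proof (induction rule: separable.induct)
  case zero
  show ?case using separable.zero by simp
next
  case (add C f w a' c')
  have "\<bar>a l * a' l\<bar> \<le> 1" for l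
    using mult_mono[OF assms(2) add.hyps(3)] by (simp add: abs_mult)
  moreover have "\<bar>c b * c' b\<bar> \<le> \<phi> b * \<psi> b" for b
    using mult_mono[OF assms(3)[of b] add.hyps(4)[of b]] assms(3)[of b]
    by (simp add: abs_mult)
  ultimately show ?case
    using separable.add[OF add.IH, of w "\<lambda>l. a l * a' l" "\<lambda>b. c b * c' b"] add.hyps(2)
    by (simp add: algebra_simps)
qed

text \<open>A product of two rank-one kernels has rank one, so the total weights multiply. Kernels
  of weight 1 can therefore be multiplied in without raising the weight; only the bound in
  \<open>b\<close> changes.\<close>

lemma separable_mult:
  assumes "separable \<phi> C f" "separable \<psi> D g"
  shows "separable (\<lambda>b. \<phi> b * \<psi> b) (C * D) (\<lambda>l b. f l b * g l b)"
  using assms(1)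
proof (induction rule: separable.induct)
  case zero
  show ?case using separable.zero by simp
next
  case (add C f w a c)
  have "separable (\<lambda>b. \<phi> b * \<psi> b) (w * D) (\<lambda>l b. w * (a l * c b * g l b))"
    by (intro separable_scale separable_mult_rank_one assms add.hyps)
  from separable_plus[OF add.IH this] show ?case
    by (simp add: algebra_simps)
qed

lemma separable_sum:
  assumes "finite J" "\<And>j. j \<in> J \<Longrightarrow> separable \<phi> (C j) (f j)"
  shows "separable \<phi> (\<Sum>j\<in>J. C j) (\<lambda>l b. \<Sum>j\<in>J. f j l b)"
  using assms by (induction J rule: finite_induct) (auto intro: separable.zero separable_plus)

lemma separable_prod:
  assumes "finite J" "\<And>j. j \<in> J \<Longrightarrow> separable (\<phi> j) 1 (f j)"
  shows "separable (\<lambda>b. \<Prod>j\<in>J. \<phi> j b) 1 (\<lambda>l b. \<Prod>j\<in>J. f j l b)"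
  using assms
proof (induction J rule: finite_induct)
  case empty
  show ?case using separable_rank_one[of "\<lambda>_. 1" "\<lambda>_. 1" "\<lambda>_. 1"] by simp
next
  case (insert j J)
  have "separable (\<lambda>b. \<phi> j b * (\<Prod>j\<in>J. \<phi> j b)) (1 * 1) (\<lambda>l b. f j l b * (\<Prod>j\<in>J. f j l b))"
    by (rule separable_mult) (use insert in auto)
  with insert.hyps show ?case by simp
qed

lemma separable_comp:
  assumes "separable \<phi> C f"
  shows "separable (\<lambda>b. \<phi> (h b)) C (\<lambda>l b. f (g l) (h b))"
  using assms
proof (induction rule: separable.induct)
  case zero
  show ?case by (rule separable.zero)
next
  case (add C f w a c)
  show ?case using separable.add[OF add.IH, of w "\<lambda>l. a (g l)" "\<lambda>b. c (h b)"] add.hyps by simp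
qed

lemma separable_mono:
  assumes "separable \<phi> C f" "C \<le> D" "\<And>b. 0 \<le> \<phi> b"
  shows "separable \<phi> D f"
  using separable.add[OF assms(1), of "D - C" "\<lambda>_. 0" "\<lambda>_. 0"] assms by simp

text \<open>The rank-one terms are laid end to end: a term of weight \<open>w\<close> gets a block
  of length \<open>w\<close>, on which both factors are constant in \<open>t\<close>. The weight is
  thus spent on time, and the factors keep their bounds.\<close>

lemma separable_has_integral:
  assumes "separable \<phi> C f" and nonneg: "\<And>b. 0 \<le> \<phi> b"
  obtains a c where "\<And>t l. \<bar>a t l\<bar> \<le> 1" "\<And>t b. \<bar>c t b\<bar> \<le> \<phi> b"
    "\<And>l b. ((\<lambda>t. a t l * c t b) has_integral f l b) {0..C}"
proof -
  have "\<exists>a c. (\<forall>t l. \<bar>a t l\<bar> \<le> 1) \<and> (\<forall>t b. \<bar>c t b\<bar> \<le> \<phi> b) \<and>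
     (\<forall>l b. ((\<lambda>t. a t l * c t b) has_integral f l b) {0..C})"
    using assms(1)
  proof (induction rule: separable.induct)
    case zero
    show ?case
      by (rule exI[of _ "\<lambda>_ _. 0"], rule exI[of _ "\<lambda>_ _. 0"]) (use nonneg in auto)
  next
    case (add C f w a' c')
    obtain a c where ac: "\<And>t l. \<bar>a t l\<bar> \<le> 1" "\<And>t b. \<bar>c t b\<bar> \<le> \<phi> b"
      "\<And>l b. ((\<lambda>t. a t l * c t b) has_integral f l b) {0..C}"
      using add.IH by blast
    define A where "A t = (if t < C then a t else a')" for t
    define B where "B t = (if t < C then c t else c')" for t
    have "((\<lambda>t. A t l * B t b) has_integral (f l b + w * (a' l * c' b))) {0..C + w}" for l b
    proof (rule has_integral_combine)
      show "0 \<le> C" "C \<le> C + w" using add.hyps separable_nonneg by auto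
      \<comment> \<open>At \<open>t = C\<close> the factors already belong to the new block; a
        single point does not change the integral.\<close>
      show "((\<lambda>t. A t l * B t b) has_integral f l b) {0..C}"
        by (rule has_integral_spike_finite[OF _ _ ac(3)[of l b], where S = "{C}"])
          (auto simp: A_def B_def)
      have "((\<lambda>t. a' l * c' b) has_integral (C + w - C) *\<^sub>R (a' l * c' b)) {C..C + w}"
        by (rule has_integral_const_real[of "a' l * c' b" C "C + w", THEN has_integral_eq_rhs])
          (use add.hyps in auto)
      moreover have "A t l * B t b = a' l * c' b" if "t \<in> {C..C + w}" for t
        using that by (simp add: A_def B_def)
      ultimately show "((\<lambda>t. A t l * B t b) has_integral w * (a' l * c' b)) {C..C + w}"
        by (subst has_integral_cong[where g = "\<lambda>t. a' l * c' b"]) auto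
    qed
    moreover have "\<bar>A t l\<bar> \<le> 1" "\<bar>B t b\<bar> \<le> \<phi> b" for t l b
      using ac add.hyps by (auto simp: A_def B_def)
    ultimately show ?case by blast
  qed
  with that show ?thesis by blast
qed

text \<open>Induction on the number of binary digits. Equality is the product of the equalities of
  the digits and keeps weight 1. For the order, either the leading digits decide, or they agree and
  the last digit decides; the second case adds weight 1, so the weight is the number of digits and
  not the number of values.\<close>

lemma separable_eq_less_than_power:
  "(\<exists>f. separable (\<lambda>_. 1) 1 f \<and> (\<forall>x<2^I. \<forall>y<2^I. f x y = of_bool (x = (y::nat)))) \<and>
   (\<exists>f. separable (\<lambda>_. 1) (real I) f \<and> (\<forall>x<2^I. \<forall>y<2^I. f x y = of_bool (y < (x::nat))))"
proof (induction I)
  case 0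
  show ?case
    using separable_rank_one[of "\<lambda>_. 1" "\<lambda>_. 1" "\<lambda>_. 1"] separable.zero by fastforce
next
  case (Suc I)
  obtain e where e: "separable (\<lambda>_. 1) 1 e" 
    "\<And>x y::nat. x < 2^I \<Longrightarrow> y < 2^I \<Longrightarrow> e x y = of_bool (x = y)"
    using Suc.IH by blast
  obtain f where f: "separable (\<lambda>_. 1) (real I) f" 
    "\<And>x y::nat. x < 2^I \<Longrightarrow> y < 2^I \<Longrightarrow> f x y = of_bool (y < x)"
    using Suc.IH by blast
  have half: "x div 2 < 2^I" if "x < 2 ^ Suc I" for x :: nat
    using that by auto
  \<comment> \<open>\<open>(1 + \<sigma> x * \<sigma> y) / 2\<close> is the indicator that the last
    digits agree: two rank-one kernels of weight 1/2 each.\<close>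
  define \<sigma> :: "nat \<Rightarrow> real" where "\<sigma> x = (if even x then 1 else -1)" for x
  have parity: "separable (\<lambda>_. 1) (1/2 * 1 + 1/2 * 1) (\<lambda>x y::nat. 1/2 * (1 * 1) + 1/2 * (\<sigma> x * \<sigma> y))"
    by (intro separable_plus separable_scale separable_rank_one) (auto simp: \<sigma>_def)
  have e2: "separable (\<lambda>_. 1) 1 (\<lambda>x y::nat. e (x div 2) (y div 2))"
    using separable_comp[OF e(1), of "\<lambda>x. x div 2" "\<lambda>x. x div 2"] .
  have f2: "separable (\<lambda>_. 1) (real I) (\<lambda>x y::nat. f (x div 2) (y div 2))"
    using separable_comp[OF f(1), of "\<lambda>x. x div 2" "\<lambda>x. x div 2"] .
  define e' where "e' x y = (1/2 * (1 * 1) + 1/2 * (\<sigma> x * \<sigma> y)) * e (x div 2) (y div 2)" for x y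
  define f' where "f' x y = f (x div 2) (y div 2) + of_bool (odd x) * of_bool (even y) * e (x div 2) (y div 2)" for x y
  have "separable (\<lambda>_. 1) 1 e'"
    using separable_mult[OF parity e2] by (simp add: e'_def[abs_def])
  moreover have "e' x y = of_bool (x = y)" if "x < 2 ^ Suc I" "y < 2 ^ Suc I" for x y :: nat
  proof -
    have "x = y \<longleftrightarrow> even x = even y \<and> x div 2 = y div 2" by presburger
    with that e(2)[OF half half] show ?thesis by (auto simp: e'_def \<sigma>_def)
  qed
  moreover have "separable (\<lambda>_. 1) (real (Suc I)) f'"
  proof -
    have "separable (\<lambda>_. 1) 1 (\<lambda>x y. of_bool (odd x) * of_bool (even y) * e (x div 2) (y div 2))"
      using separable_mult_rank_one[OF e2, of "\<lambda>x. of_bool (odd x)" "\<lambda>x. of_bool (even x)" "\<lambda>_. 1"]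
      by simp
    from separable_plus[OF f2 this] show ?thesis
      by (simp add: f'_def[abs_def] add.commute)
  qed
  moreover have "f' x y = of_bool (y < x)" if "x < 2 ^ Suc I" "y < 2 ^ Suc I" for x y :: nat
  proof -
    have "y < x \<longleftrightarrow> y div 2 < x div 2 \<or> (odd x \<and> even y \<and> x div 2 = y div 2)" by presburger
    with that e(2)[OF half half] f(2)[OF half half] show ?thesis by (auto simp: f'_def)
  qed
  ultimately show ?case by blast
qed

text \<open>The condition says that \<open>l\<close> exceeds
  \<open>\<lceil>M / b\<rceil> - 1\<close>, a comparison of \<open>l\<close> with a function of
  \<open>b\<close>. Only \<open>l\<close> has to be bounded, since the threshold can be cut off at
  \<open>2^I - 1\<close>.\<close>

lemma separable_threshold:
  fixes M :: real
  assumes "0 < M"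
  obtains f where "separable (\<lambda>_. 1) (real I) f"
    "\<And>l b::nat. l < 2 ^ I \<Longrightarrow> 1 \<le> b \<Longrightarrow> f l b = of_bool (M \<le> real (l * b))"
proof -
  obtain f where f: "separable (\<lambda>_. 1) (real I) f" 
    "\<And>x y::nat. x < 2^I \<Longrightarrow> y < 2^I \<Longrightarrow> f x y = of_bool (y < x)"
    using separable_eq_less_than_power[of I] by blast
  \<comment> \<open>The cap is harmless: no \<open>l < 2^I\<close> exceeds \<open>2^I - 1\<close>.
    The subtraction is exact because \<open>0 < M\<close> makes the ceiling at least 1 for
    \<open>1 \<le> b\<close>.\<close>
  define h :: "nat \<Rightarrow> nat" where "h b = min (2^I - 1) (nat \<lceil>M / real b\<rceil> - 1)" for b
  have "f l (h b) = of_bool (M \<le> real (l * b))" if "l < 2 ^ I" "1 \<le> b" for l b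
  proof -
    have "h b < 2 ^ I" unfolding h_def by (simp add: min_less_iff_disj)
    have pos: "1 \<le> \<lceil>M / real b\<rceil>" using assms that by simp
    have "h b < l \<longleftrightarrow> nat \<lceil>M / real b\<rceil> - 1 < l"
      using that by (auto simp: h_def)
    also have "\<dots> \<longleftrightarrow> \<lceil>M / real b\<rceil> \<le> int l" using pos by linarith
    also have "\<dots> \<longleftrightarrow> M / real b \<le> real l" by (simp add: ceiling_le_iff)
    also have "\<dots> \<longleftrightarrow> M \<le> real (l * b)" using that by (simp add: field_simps)
    finally show ?thesis using f(2)[OF that(1) \<open>h b < 2 ^ I\<close>] by simp
  qed
  moreover have "separable (\<lambda>_. 1) (real I) (\<lambda>l b. f l (h b))"
    using separable_comp[OF f(1), of "\<lambda>l. l" h] .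
  ultimately show ?thesis by (rule that[rotated])
qed

section \<open>Random subsets and Riemann sums\<close>

text \<open>Russo's formula for the expectation of \<open>v\<close> at a random subset of
  \<open>D\<close> that contains \<open>p\<close> with probability \<open>y p\<close>. In the
  product rule, the sets \<open>A\<close> containing \<open>p\<close> are paired with
  \<open>A - {p}\<close>: the derivatives of their factors at \<open>p\<close> are
  \<open>y' p\<close> and \<open>- y' p\<close>, and all other factors agree.\<close>

lemma random_subset_has_derivative:
  fixes y :: "'a \<Rightarrow> real \<Rightarrow> real"
  assumes "finite D" and y: "\<And>p. p \<in> D \<Longrightarrow> (y p has_real_derivative y' p) (at x)"
  shows "((\<lambda>u. \<Sum>A\<in>Pow D. v A * ((\<Prod>p\<in>A. y p u) * (\<Prod>p\<in>D - A. 1 - y p u)))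
     has_real_derivative
     (\<Sum>A\<in>Pow D. \<Sum>p\<in>A. (v A - v (A - {p})) * (y' p * (\<Prod>q\<in>A - {p}. y q x)
        * (\<Prod>q\<in>D - A. 1 - y q x)))) (at x)"
proof -
  define s where "s A p u = (if p \<in> A then y p u else 1 - y p u)" for A p u
  define R where "R A p = (\<Prod>q\<in>D - {p}. s A q x)" for A p
  define h where "h p A = v A * ((if p \<in> A then y' p else - y' p) * R A p)" for p A
  have prod_s: "(\<Prod>p\<in>A. y p u) * (\<Prod>p\<in>D - A. 1 - y p u) = (\<Prod>p\<in>D. s A p u)"
    if "A \<in> Pow D" for A u
  proof -
    have "(\<Prod>p\<in>D. s A p u) = (\<Prod>p\<in>A. s A p u) * (\<Prod>p\<in>D - A. s A p u)"
      using prod.subset_diff[of A D "\<lambda>p. s A p u"] that assms(1) by (simp add: mult.commute)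
    then show ?thesis by (simp add: s_def)
  qed
  have "(s A p has_real_derivative (if p \<in> A then y' p else - y' p)) (at x)" if "p \<in> D" for A p
    unfolding s_def using y[OF that] by (cases "p \<in> A") (auto intro!: derivative_eq_intros)
  then have "((\<lambda>u. \<Sum>A\<in>Pow D. v A * (\<Prod>p\<in>D. s A p u)) has_real_derivative
     (\<Sum>A\<in>Pow D. v A * (\<Sum>p\<in>D. (if p \<in> A then y' p else - y' p) * R A p))) (at x)"
    unfolding R_def by (intro DERIV_sum DERIV_cmult has_field_derivative_prod)
  moreover have "(\<Sum>A\<in>Pow D. v A * (\<Sum>p\<in>D. (if p \<in> A then y' p else - y' p) * R A p)) =
     (\<Sum>A\<in>Pow D. \<Sum>p\<in>A. (v A - v (A - {p})) * (y' p * (\<Prod>q\<in>A - {p}. y q x)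
        * (\<Prod>q\<in>D - A. 1 - y q x)))"
  proof -
    have "(\<Sum>A\<in>Pow D. v A * (\<Sum>p\<in>D. (if p \<in> A then y' p else - y' p) * R A p)) =
       (\<Sum>p\<in>D. \<Sum>A\<in>Pow D. h p A)"
      unfolding h_def by (subst sum.swap) (simp add: sum_distrib_left)
    also have "\<dots> = (\<Sum>p\<in>D. \<Sum>A\<in>{A\<in>Pow D. p \<in> A}. h p A + h p (A - {p}))"
    proof (rule sum.cong[OF refl])
      fix p assume p: "p \<in> D"
      have "(\<Sum>A\<in>Pow D. h p A) =
          (\<Sum>A\<in>{A\<in>Pow D. p \<in> A}. h p A) + (\<Sum>A\<in>{A\<in>Pow D. p \<notin> A}. h p A)"
        using assms(1)
        by (subst sum.union_disjoint[symmetric]) (auto intro!: sum.cong)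
      also have "(\<Sum>A\<in>{A\<in>Pow D. p \<notin> A}. h p A) = (\<Sum>A\<in>{A\<in>Pow D. p \<in> A}. h p (A - {p}))"
        by (rule sum.reindex_bij_witness[of _ "\<lambda>A. A - {p}" "insert p"]) (use p in auto)
      finally show "(\<Sum>A\<in>Pow D. h p A) = (\<Sum>A\<in>{A\<in>Pow D. p \<in> A}. h p A + h p (A - {p}))"
        by (simp add: sum.distrib)
    qed
    also have "\<dots> = (\<Sum>A\<in>Pow D. \<Sum>p\<in>{p\<in>D. p \<in> A}. h p A + h p (A - {p}))"
      using sum.swap_restrict[of D "Pow D" "\<lambda>p A. h p A + h p (A - {p})" "\<lambda>p A. p \<in> A"] assms(1) by simp
    also have "\<dots> = (\<Sum>A\<in>Pow D. \<Sum>p\<in>A. (v A - v (A - {p})) * (y' p * (\<Prod>q\<in>A - {p}. y q x)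
        * (\<Prod>q\<in>D - A. 1 - y q x)))"
    proof (intro sum.cong)
      fix A p assume A: "A \<in> Pow D" and p: "p \<in> A"
      have "R (A - {p}) p = R A p"
        unfolding R_def s_def by (intro prod.cong) auto
      moreover have "R A p = (\<Prod>q\<in>A - {p}. y q x) * (\<Prod>q\<in>D - A. 1 - y q x)"
      proof -
        have "D - {p} - (A - {p}) = D - A" using p by auto
        then have "R A p = (\<Prod>q\<in>D - A. s A q x) * (\<Prod>q\<in>A - {p}. s A q x)"
          using prod.subset_diff[of "A - {p}" "D - {p}" "\<lambda>q. s A q x"] A assms(1)
          by (auto simp: R_def)
        then show ?thesis by (simp add: s_def)
      qed
      ultimately show "h p A + h p (A - {p}) = (v A - v (A - {p})) * (y' p * (\<Prod>q\<in>A - {p}. y q x)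
        * (\<Prod>q\<in>D - A. 1 - y q x))"
        using p by (simp add: h_def algebra_simps)
    qed (use assms in auto)
    finally show ?thesis .
  qed
  moreover have "(\<lambda>u. \<Sum>A\<in>Pow D. v A * ((\<Prod>p\<in>A. y p u) * (\<Prod>p\<in>D - A. 1 - y p u))) =
      (\<lambda>u. \<Sum>A\<in>Pow D. v A * (\<Prod>p\<in>D. s A p u))"
    by (intro ext sum.cong refl) (simp only: prod_s)
  ultimately show ?thesis by simp
qed

text \<open>On each cell the mean value theorem writes the increment of \<open>G\<close> as
  \<open>1 / n\<close> times a value of \<open>g\<close> inside the cell, and uniform continuity
  moves that value to the left endpoint. Finite sums suit \<open>separable\<close>, which admits
  only finitely many terms.\<close>

lemma left_riemann_sum_tendsto:
  fixes G g :: "real \<Rightarrow> real"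
  assumes deriv: "\<And>x. x \<in> {0..1} \<Longrightarrow> (G has_real_derivative g x) (at x)"
    and cont: "continuous_on {0..1} g"
  shows "(\<lambda>n. \<Sum>i<n. g (real i / real n) / real n) \<longlonglongrightarrow> G 1 - G 0"
proof (rule LIMSEQ_I)
  fix e :: real assume e: "0 < e"
  have "uniformly_continuous_on {0..1} g"
    by (rule compact_uniformly_continuous[OF cont]) simp
  then obtain d where d: "0 < d"
    "\<And>x y. x \<in> {0..1} \<Longrightarrow> y \<in> {0..1} \<Longrightarrow> dist y x < d \<Longrightarrow> dist (g y) (g x) < e / 2"
    using e unfolding uniformly_continuous_on_def by (meson half_gt_zero)
  obtain n0 :: nat where n0: "1 / d < real n0" using reals_Archimedean2 by blast
  show "\<exists>n0. \<forall>n\<ge>n0. norm ((\<Sum>i<n. g (real i / real n) / real n) - (G 1 - G 0)) < e"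
  proof (intro exI allI impI)
    fix n assume n: "Suc n0 \<le> n"
    then have "1 / d < real n" and n0: "0 < real n" using n0 by auto
    then have step: "1 / real n < d" using d(1) by (simp add: field_simps)
    have incr: "\<bar>g (real i / real n) / real n - (G (real (Suc i) / real n) - G (real i / real n))\<bar>
        \<le> e / 2 / real n" if "i < n" for i
    proof -
      have i: "0 \<le> real i / real n" "real i / real n < real (Suc i) / real n" "real (Suc i) / real n \<le> 1"
        using that n0 by (auto simp: field_simps)
      obtain \<xi> where \<xi>: "real i / real n < \<xi>" "\<xi> < real (Suc i) / real n"
        "G (real (Suc i) / real n) - G (real i / real n) = (real (Suc i) / real n - real i / real n) * g \<xi>"
        using MVT2[OF i(2), of G g] deriv i by (smt (verit) atLeastAtMost_iff)
      have "real (Suc i) / real n - real i / real n = 1 / real n"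
        by (simp add: diff_divide_distrib[symmetric])
      with \<xi> step have "dist (real i / real n) \<xi> < d" by (auto simp: dist_real_def)
      then have "\<bar>g (real i / real n) - g \<xi>\<bar> < e / 2"
        using d(2)[of \<xi> "real i / real n"] i \<xi> by (auto simp: dist_real_def)
      moreover have "g (real i / real n) / real n - (G (real (Suc i) / real n) - G (real i / real n))
          = (g (real i / real n) - g \<xi>) / real n"
        using \<xi>(3) \<open>real (Suc i) / real n - real i / real n = 1 / real n\<close>
        by (simp add: diff_divide_distrib)
      moreover have "\<bar>(g (real i / real n) - g \<xi>) / real n\<bar> \<le> e / 2 / real n"
        using \<open>\<bar>g (real i / real n) - g \<xi>\<bar> < e / 2\<close> n0 by (simp add: abs_divide field_simps)
      ultimately show ?thesis by (simp only:)
    qed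
    have "G 1 - G 0 = (\<Sum>i<n. G (real (Suc i) / real n) - G (real i / real n))"
      using sum_lessThan_telescope[of "\<lambda>i. G (real i / real n)" n] n0 by simp
    then have "\<bar>(\<Sum>i<n. g (real i / real n) / real n) - (G 1 - G 0)\<bar> =
       \<bar>\<Sum>i<n. g (real i / real n) / real n - (G (real (Suc i) / real n) - G (real i / real n))\<bar>"
      by (simp only: sum_subtractf)
    also have "\<dots> \<le> (\<Sum>i<n. e / 2 / real n)"
      by (rule order_trans[OF sum_abs sum_mono]) (use incr in auto)
    also have "\<dots> = e / 2" using n0 by simp
    finally show "norm ((\<Sum>i<n. g (real i / real n) / real n) - (G 1 - G 0)) < e"
      using e by simp
  qed
qed

text \<open>Left sums of an increasing function lie below its integral; cell by cell the comparison
  is with the increment of \<open>x ^ m\<close>. The bound holds for every \<open>n\<close>, so the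
  weight of the kernel will not depend on the fineness of the Riemann sum.\<close>

lemma sum_left_endpoints_power_le:
  assumes "0 < m"
  shows "(\<Sum>i<n. (real i / real n) ^ (m - 1) / real n) \<le> 1 / real m"
proof (cases "n = 0")
  case False
  have "real m * ((real i / real n) ^ (m - 1) / real n)
      \<le> (real (Suc i) / real n) ^ m - (real i / real n) ^ m" for i
  proof -
    let ?x = "real i / real n" and ?y = "real (Suc i) / real n"
    have xy: "0 \<le> ?x" "?x < ?y" "?y - ?x = 1 / real n"
      using False by (auto simp: field_simps)
    obtain \<xi> where \<xi>: "?x < \<xi>" "\<xi> < ?y" "?y ^ m - ?x ^ m = (?y - ?x) * (real m * \<xi> ^ (m - 1))"
      using MVT2[OF xy(2), of "\<lambda>x. x ^ m" "\<lambda>x. real m * x ^ (m - 1)"] DERIV_pow by fastforce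
    have "?x ^ (m - 1) \<le> \<xi> ^ (m - 1)" using \<xi> xy by (intro power_mono) auto
    then show ?thesis unfolding \<xi>(3) xy(3)
      by (simp add: divide_right_mono mult_left_mono)
  qed
  then have "real m * (\<Sum>i<n. (real i / real n) ^ (m - 1) / real n)
      \<le> (\<Sum>i<n. (real (Suc i) / real n) ^ m - (real i / real n) ^ m)"
    unfolding sum_distrib_left by (intro sum_mono) auto
  also have "\<dots> = 1"
    using sum_lessThan_telescope[of "\<lambda>i. (real i / real n) ^ m" n] False assms by simp
  finally show ?thesis using assms by (simp add: field_simps)
qed simp

section \<open>Products of distinct primes\<close>

lemma prime_dvd_prod_primes_iff:
  fixes A :: "nat set"
  assumes "finite A" "\<And>p. p \<in> A \<Longrightarrow> prime p" "prime q"
  shows "q dvd \<Prod>A \<longleftrightarrow> q \<in> A"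
  using assms(1,3) prime_dvd_prod_iff[of A q "\<lambda>p. p"] primes_dvd_imp_eq[OF assms(3) assms(2)]
  by auto

lemma prod_primes_pos:
  fixes A :: "nat set"
  assumes "\<And>p. p \<in> A \<Longrightarrow> prime p"
  shows "0 < \<Prod>A"
  using assms by (intro prod_pos) (auto simp: prime_gt_0_nat)

lemma prime_factors_prod_primes:
  fixes A :: "nat set"
  assumes "finite A" "\<And>p. p \<in> A \<Longrightarrow> prime p"
  shows "prime_factors (\<Prod>A) = A"
proof -
  have "\<Prod>A \<noteq> 0" using prod_primes_pos[OF assms(2)] by simp
  then show ?thesis
    using prime_dvd_prod_primes_iff[OF assms] assms(2) by (auto simp: in_prime_factors_iff)
qed

lemma squarefree_prod_primes:
  fixes A :: "nat set"
  assumes "\<And>p. p \<in> A \<Longrightarrow> prime p"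
  shows "squarefree (\<Prod>A)"
  using assms by (intro squarefree_prod_coprime) (auto simp: primes_coprime squarefree_prime)

lemma moebius_mu_prod_primes:
  assumes "finite A" "\<And>p. p \<in> A \<Longrightarrow> prime p"
  shows "moebius_mu (\<Prod>A) = (-1) ^ card A"
  using prime_factors_prod_primes[OF assms] squarefree_prod_primes[OF assms(2)]
  by (simp add: moebius_mu_def)

lemma inj_on_prod_primes:
  fixes Q :: "nat set"
  assumes "finite Q" "\<And>p. p \<in> Q \<Longrightarrow> prime p"
  shows "inj_on Prod (Pow Q)"
proof (rule inj_onI)
  fix A B assume "A \<in> Pow Q" "B \<in> Pow Q" "\<Prod>A = \<Prod>B"
  then show "A = B"
    using prime_factors_prod_primes[of A] prime_factors_prod_primes[of B] assms
    by (metis PowD finite_subset subsetD)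
qed

lemma prod_prime_factors_squarefree:
  fixes d :: nat
  assumes "squarefree d"
  shows "\<Prod>(prime_factors d) = d"
proof -
  have "d \<noteq> 0" using assms by (metis not_squarefree_0)
  have "d = (\<Prod>p\<in>prime_factors d. p ^ multiplicity p d)"
    using prime_factorization_nat \<open>d \<noteq> 0\<close> by blast
  also have "\<dots> = \<Prod>(prime_factors d)"
    using assms \<open>d \<noteq> 0\<close> by (intro prod.cong) (auto simp: squarefree_factorial_semiring')
  finally show ?thesis ..
qed

lemma divisors_prod_primes:
  fixes Q :: "nat set"
  assumes "finite Q" "\<And>p. p \<in> Q \<Longrightarrow> prime p"
  shows "{d. d dvd \<Prod>Q} = Prod ` Pow Q"
proof (intro equalityI subsetI)
  fix d assume "d \<in> {d. d dvd \<Prod>Q}"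
  then have d: "d dvd \<Prod>Q" by simp
  then have "squarefree d" using squarefree_prod_primes[OF assms(2)] squarefree_mono by blast
  moreover have "prime_factors d \<subseteq> Q"
    using dvd_prime_factors[OF _ d] prod_primes_pos[OF assms(2)] prime_factors_prod_primes[OF assms]
    by auto
  ultimately show "d \<in> Prod ` Pow Q"
    using prod_prime_factors_squarefree by (metis PowI imageI)
next
  fix d assume "d \<in> Prod ` Pow Q"
  then show "d \<in> {d. d dvd \<Prod>Q}" using assms(1) by (auto intro: prod_dvd_prod_subset)
qed

lemma sum_divisors_prod_primes:
  fixes Q :: "nat set"
  assumes "finite Q" "\<And>p. p \<in> Q \<Longrightarrow> prime p"
  shows "(\<Sum>d\<in>{d. d dvd \<Prod>Q}. h d) = (\<Sum>A\<in>Pow Q. h (\<Prod>A))"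
proof -
  have "(\<Sum>d\<in>{d. d dvd \<Prod>Q}. h d) = sum h (Prod ` Pow Q)"
    by (rule sum.cong[OF divisors_prod_primes]) (use assms in auto)
  then show ?thesis using sum.reindex[OF inj_on_prod_primes[OF assms], of h] by simp
qed

lemma coprime_prod_primes_iff:
  fixes Q :: "nat set"
  assumes "finite Q" "\<And>p. p \<in> Q \<Longrightarrow> prime p"
  shows "coprime n (\<Prod>Q) \<longleftrightarrow> (\<forall>p\<in>Q. \<not> p dvd n)"
proof
  assume cop: "coprime n (\<Prod>Q)"
  show "\<forall>p\<in>Q. \<not> p dvd n"
  proof (intro ballI notI)
    fix p assume "p \<in> Q" "p dvd n"
    then have "p dvd 1" using cop assms by (meson coprime_common_divisor dvd_prodI)
    then show False using assms(2)[OF \<open>p \<in> Q\<close>] by simp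
  qed
next
  assume "\<forall>p\<in>Q. \<not> p dvd n"
  then show "coprime n (\<Prod>Q)"
    using assms by (intro prod_coprime_right) (metis coprime_commute prime_imp_coprime)
qed

lemma prod_primes_dvd:
  fixes A :: "nat set"
  assumes "finite A" "\<And>p. p \<in> A \<Longrightarrow> prime p" "\<And>p. p \<in> A \<Longrightarrow> p dvd n"
  shows "\<Prod>A dvd n"
  using assms
proof (induction A rule: finite_induct)
  case (insert p A)
  have "\<not> q dvd p" if "q \<in> A" for q
    using primes_dvd_imp_eq[of q p] insert.prems(1) insert.hyps(2) that by auto
  then have "coprime p (\<Prod>A)"
    using coprime_prod_primes_iff[of A p] insert.hyps(1) insert.prems(1) by simp
  with insert show ?case by (simp add: divides_mult)
qed simp

text \<open>The common divisors are the products over subsets of the set \<open>D\<close> of primes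
  in \<open>Q\<close> dividing \<open>n\<close>, so the sum is the expansion of the product of
  \<open>-1 + 1\<close> over \<open>D\<close>.\<close>

lemma sum_moebius_mu_eq_coprime:
  fixes Q :: "nat set"
  assumes "finite Q" "\<And>p. p \<in> Q \<Longrightarrow> prime p"
  shows "(\<Sum>d\<in>{d. d dvd \<Prod>Q \<and> d dvd n}. moebius_mu d) = of_bool (coprime n (\<Prod>Q))"
proof -
  define D where "D = {p\<in>Q. p dvd n}"
  have D: "finite D" "\<And>p. p \<in> D \<Longrightarrow> prime p" using assms by (auto simp: D_def)
  have "{d. d dvd \<Prod>Q \<and> d dvd n} = {d. d dvd \<Prod>D}"
  proof (intro equalityI subsetI)
    fix d assume d: "d \<in> {d. d dvd \<Prod>Q \<and> d dvd n}"
    then obtain A where A: "A \<subseteq> Q" "d = \<Prod>A"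
      using divisors_prod_primes[OF assms] by auto
    have "A \<subseteq> D"
    proof
      fix p assume "p \<in> A"
      then have "p dvd d" using A assms(1) by (auto intro: dvd_prodI finite_subset)
      then show "p \<in> D" using d A \<open>p \<in> A\<close> by (auto simp: D_def intro: dvd_trans)
    qed
    then show "d \<in> {d. d dvd \<Prod>D}" using A D by (auto intro: prod_dvd_prod_subset)
  next
    fix d assume d: "d \<in> {d. d dvd \<Prod>D}"
    have "\<Prod>D dvd \<Prod>Q" using assms(1) by (auto intro!: prod_dvd_prod_subset simp: D_def)
    moreover have "\<Prod>D dvd n"
      by (rule prod_primes_dvd) (use assms in \<open>auto simp: D_def\<close>)
    ultimately show "d \<in> {d. d dvd \<Prod>Q \<and> d dvd n}" using d by (auto intro: dvd_trans)
  qed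
  then have "(\<Sum>d\<in>{d. d dvd \<Prod>Q \<and> d dvd n}. moebius_mu d) = (\<Sum>A\<in>Pow D. moebius_mu (\<Prod>A))"
    using sum_divisors_prod_primes[OF D] by simp
  also have "\<dots> = (\<Sum>A\<in>Pow D. (\<Prod>p\<in>A. -1) * (\<Prod>p\<in>D - A. 1))"
  proof (intro sum.cong refl)
    fix A assume "A \<in> Pow D"
    then have "finite A" "\<And>p. p \<in> A \<Longrightarrow> prime p" using D finite_subset by auto
    then show "moebius_mu (\<Prod>A) = (\<Prod>p\<in>A. -1) * (\<Prod>p\<in>D - A. 1)"
      by (simp add: moebius_mu_prod_primes)
  qed
  also have "\<dots> = (\<Prod>p\<in>D. -1 + 1)"
    using prod_add[OF D(1), of "\<lambda>_. -1" "\<lambda>_. 1::int"] by simp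
  also have "\<dots> = of_bool (D = {})"
    using D by auto
  also have "D = {} \<longleftrightarrow> coprime n (\<Prod>Q)"
    using coprime_prod_primes_iff[of Q n] assms by (auto simp: D_def)
  finally show ?thesis .
qed

section \<open>Divisor counts and the bound by \<open>tau3\<close>\<close>

lemma two_power_card_prime_factors_le_divisors:
  fixes Q :: "nat set"
  assumes "finite Q" "\<And>p. p \<in> Q \<Longrightarrow> prime p" "0 < b"
  shows "2 ^ card {p\<in>Q. p dvd b} \<le> card {e. e dvd b}"
proof -
  let ?D = "{p\<in>Q. p dvd b}"
  have D: "finite ?D" "\<And>p. p \<in> ?D \<Longrightarrow> prime p" using assms by auto
  have "\<Prod>?D dvd b"
    by (rule prod_primes_dvd) (use assms in auto)
  then have "Prod ` Pow ?D \<subseteq> {e. e dvd b}"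
    using divisors_prod_primes[OF D] by (auto intro: dvd_trans)
  then have "card (Prod ` Pow ?D) \<le> card {e. e dvd b}"
    using assms(3) by (intro card_mono) auto
  then show ?thesis
    using card_image[OF inj_on_prod_primes[OF D]] D by (simp add: card_Pow)
qed

text \<open>A divisor \<open>b\<close> of \<open>k\<close> together with a divisor \<open>e\<close>
  of \<open>b\<close> yields the factorization \<open>k = e * (b div e) * (k div b)\<close>, from
  which \<open>b\<close> and \<open>e\<close> can be recovered.\<close>

lemma sum_two_power_card_prime_factors_le_tau3:
  fixes Q :: "nat set"
  assumes "finite Q" "\<And>p. p \<in> Q \<Longrightarrow> prime p" "0 < k"
  shows "(\<Sum>b\<in>{b. b dvd k}. 2 ^ card {p\<in>Q. p dvd b}) \<le> tau3 k"
proof -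
  \<comment> \<open>Finiteness matters because \<open>card\<close> of an infinite set is 0.\<close>
  have fin: "finite {(d1, d2, d3). d1 * d2 * d3 = k}"
  proof (rule finite_subset)
    have "a \<le> k \<and> b \<le> k \<and> c \<le> k" if "a * b * c = k" for a b c
      using that assms(3) by (auto intro!: dvd_imp_le)
    then show "{(d1, d2, d3). d1 * d2 * d3 = k} \<subseteq> {..k} \<times> {..k} \<times> {..k}"
      by auto
  qed simp
  have "(\<Sum>b\<in>{b. b dvd k}. 2 ^ card {p\<in>Q. p dvd b}) \<le> (\<Sum>b\<in>{b. b dvd k}. card {e. e dvd b})"
  proof (rule sum_mono)
    fix b assume "b \<in> {b. b dvd k}"
    then have "0 < b" using assms(3) by (auto intro: Nat.gr0I)
    then show "2 ^ card {p\<in>Q. p dvd b} \<le> card {e. e dvd b}"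
      using two_power_card_prime_factors_le_divisors assms by blast
  qed
  also have "\<dots> = card (SIGMA b:{b. b dvd k}. {e. e dvd b})"
    using assms(3) by (subst card_SigmaI) (auto intro: finite_divisors_nat Nat.gr0I)
  also have "\<dots> \<le> card {(d1, d2, d3). d1 * d2 * d3 = k}"
  proof (rule card_inj_on_le[OF _ _ fin])
    show "inj_on (\<lambda>(b, e). (e, b div e, k div b)) (SIGMA b:{b. b dvd k}. {e. e dvd b})"
      by (auto simp: inj_on_def) (metis dvd_mult_div_cancel)
    show "(\<lambda>(b, e). (e, b div e, k div b)) ` (SIGMA b:{b. b dvd k}. {e. e dvd b})
        \<subseteq> {(d1, d2, d3). d1 * d2 * d3 = k}"
      by auto
  qed
  finally show ?thesis by (simp add: tau3_def)
qed

section \<open>Random factorizations\<close>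

text \<open>Let a random set contain \<open>p\<close> with probability \<open>y p\<close>, independently. The kernel averages the condition
  that the primes of \<open>l\<close> lie in the set and those of \<open>b\<close> outside, weighted by \<open>1 + y p\<close> for each \<open>p dvd b\<close>.\<close>

definition coprime_kernel :: "nat set \<Rightarrow> (nat \<Rightarrow> real) \<Rightarrow> nat \<Rightarrow> nat \<Rightarrow> real" where
  "coprime_kernel Q y l b = (\<Prod>p\<in>Q. y p * of_bool (\<not> p dvd b)
     + (1 - y p) * (of_bool (\<not> p dvd l) * (if p dvd b then 1 + y p else 1)))"

text \<open>Each prime contributes a mixture of two rank-one kernels with weights \<open>y p\<close>
  and \<open>1 - y p\<close>, which add up to 1; hence the product over \<open>Q\<close> still has
  weight 1. The price is the factor \<open>1 + y p \<le> 2\<close> for each prime of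
  \<open>b\<close>.\<close>

lemma separable_coprime_kernel:
  assumes "finite Q" "\<And>p. p \<in> Q \<Longrightarrow> 0 \<le> y p \<and> y p \<le> 1"
  shows "separable (\<lambda>b. 2 ^ card {p\<in>Q. p dvd b}) 1 (coprime_kernel Q y)"
proof -
  have "separable (\<lambda>b. if p dvd b then 2 else 1) 1
     (\<lambda>l b. y p * of_bool (\<not> p dvd b) + (1 - y p) * (of_bool (\<not> p dvd l) * (if p dvd b then 1 + y p else 1)))"
    if p: "p \<in> Q" for p
  proof -
    have "separable (\<lambda>b. if p dvd b then 2 else 1) (y p * 1 + (1 - y p) * 1)
     (\<lambda>l b. y p * (1 * of_bool (\<not> p dvd b)) + (1 - y p) * (of_bool (\<not> p dvd l) * (if p dvd b then 1 + y p else 1)))"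
      by (intro separable_plus separable_scale separable_rank_one) (use assms(2)[OF p] in auto)
    then show ?thesis by simp
  qed
  from separable_prod[OF assms(1) this]
  have "separable (\<lambda>b. \<Prod>p\<in>Q. if p dvd b then 2 else 1) 1 (coprime_kernel Q y)"
    unfolding coprime_kernel_def[abs_def] .
  moreover have "(\<Prod>p\<in>Q. if p dvd b then 2 else (1::real)) = 2 ^ card {p\<in>Q. p dvd b}" for b
    using prod.inter_filter[OF assms(1), of "\<lambda>_. 2::real" "\<lambda>p. p dvd b"] by simp
  ultimately show ?thesis by simp
qed

text \<open>Since \<open>(1 - y) * (1 + y) = 1 - y\<^sup>2\<close>, the primes of \<open>B\<close>
  get the probability of having left when survival has probability \<open>y\<^sup>2\<close>, whereas
  those of \<open>A\<close> get only \<open>y\<close>. The missing factor \<open>y\<close> can be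
  supplied as a function of \<open>l\<close> alone. A prime in both sets gives 0, a prime in neither
  gives 1.\<close>

lemma coprime_kernel_prod_primes:
  assumes Q: "finite Q" "\<And>p. p \<in> Q \<Longrightarrow> prime p" and AB: "A \<subseteq> Q" "B \<subseteq> Q"
  shows "coprime_kernel Q y (\<Prod>A) (\<Prod>B) =
     (if A \<inter> B = {} then (\<Prod>p\<in>A. y p) * (\<Prod>p\<in>B. 1 - (y p)\<^sup>2) else 0)"
proof -
  have fin: "finite A" "finite B" using AB finite_subset[OF _ Q(1)] by auto
  have primes: "\<forall>p\<in>A. prime p" "\<forall>p\<in>B. prime p" using AB Q(2) by auto
  have dvd: "p dvd \<Prod>A \<longleftrightarrow> p \<in> A" "p dvd \<Prod>B \<longleftrightarrow> p \<in> B" if "p \<in> Q" for p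
    using prime_dvd_prod_primes_iff[of A p] prime_dvd_prod_primes_iff[of B p] fin primes Q(2)[OF that]
    by simp_all
  have eq: "coprime_kernel Q y (\<Prod>A) (\<Prod>B) = (\<Prod>p\<in>Q. if p \<in> A then (if p \<in> B then 0 else y p)
     else if p \<in> B then 1 - (y p)\<^sup>2 else 1)"
    unfolding coprime_kernel_def
    by (intro prod.cong refl) (auto simp: dvd power2_eq_square algebra_simps)
  show ?thesis
  proof (cases "A \<inter> B = {}")
    case True
    have "coprime_kernel Q y (\<Prod>A) (\<Prod>B) = (\<Prod>p\<in>Q. (if p \<in> A then y p else 1) * (if p \<in> B then 1 - (y p)\<^sup>2 else 1))"
      unfolding eq using True by (intro prod.cong refl) auto
    also have "\<dots> = (\<Prod>p\<in>Q \<inter> A. y p) * (\<Prod>p\<in>Q \<inter> B. 1 - (y p)\<^sup>2)"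
      by (simp only: prod.distrib prod.inter_restrict[OF Q(1)])
    finally show ?thesis using True AB by (simp add: Int_absorb1)
  next
    case False
    then obtain p where "p \<in> A" "p \<in> B" by auto
    then have "coprime_kernel Q y (\<Prod>A) (\<Prod>B) = 0"
      unfolding eq using AB Q(1) by (intro prod_zero) auto
    with False show ?thesis by simp
  qed
qed

section \<open>Truncated logarithms and the crossing of \<open>M0\<close>\<close>

lemma ex_ceiling_log2:
  fixes x :: real
  assumes "1 < x"
  obtains K :: nat where "0 < K" "2 ^ (K - 1) < x" "x \<le> 2 ^ K"
proof -
  define K where "K = (LEAST K::nat. x \<le> 2 ^ K)"
  obtain k where "x < 2 ^ k" using real_arch_pow[of 2 x] by auto
  then have K: "x \<le> 2 ^ K" unfolding K_def by (intro LeastI[of "\<lambda>K. x \<le> 2 ^ K" k]) simp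
  have "0 < K" using K assms by (cases K) auto
  then have "\<not> x \<le> 2 ^ (K - 1)"
    using not_less_Least[of "K - 1" "\<lambda>K. x \<le> 2 ^ K"] unfolding K_def[symmetric] by simp
  with that K \<open>0 < K\<close> show ?thesis by simp
qed

text \<open>A prime with \<open>floor_log p \<ge> K\<close> suffices by itself. Otherwise nothing is
  truncated, and \<open>p < 2 ^ (floor_log p + 1) \<le> 2 ^ (2 * floor_log p)\<close> bounds the
  product; the factor 2 pays for rounding down the logarithms.\<close>

lemma truncated_log_sum_ge:
  fixes x :: real
  assumes A: "finite A" "\<And>p. p \<in> A \<Longrightarrow> prime p" and x: "2 ^ (K - 1) < x" "x \<le> real (\<Prod>A)"
  shows "K \<le> 2 * (\<Sum>p\<in>A. min (floor_log p) K)"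
proof (cases "\<exists>p\<in>A. K \<le> floor_log p")
  case True
  then obtain p where "p \<in> A" "min (floor_log p) K = K" by auto
  then have "K \<le> (\<Sum>p\<in>A. min (floor_log p) K)"
    using A(1) member_le_sum[of p A "\<lambda>p. min (floor_log p) K"] by simp
  then show ?thesis by simp
next
  case False
  have "\<Prod>A \<le> (\<Prod>p\<in>A. 2 ^ (2 * floor_log p))"
  proof (rule prod_mono)
    fix p assume "p \<in> A"
    then have "2 \<le> p" using A prime_ge_2_nat by blast
    then have "1 \<le> floor_log p" by (subst floor_log_rec) auto
    then have "(2::nat) ^ Suc (floor_log p) \<le> 2 ^ (2 * floor_log p)"
      by (intro power_increasing) auto
    then show "0 \<le> p \<and> p \<le> 2 ^ (2 * floor_log p)" using floor_log_exp2_ge[of p] by simp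
  qed
  also have "\<dots> = 2 ^ (2 * (\<Sum>p\<in>A. floor_log p))"
    by (simp add: power_sum sum_distrib_left)
  also have "(\<Sum>p\<in>A. floor_log p) = (\<Sum>p\<in>A. min (floor_log p) K)"
    using False by (intro sum.cong) auto
  finally have "real (\<Prod>A) \<le> 2 ^ (2 * (\<Sum>p\<in>A. min (floor_log p) K))"
    by (metis of_nat_le_iff of_nat_numeral of_nat_power)
  with x have "(2::real) ^ (K - 1) < 2 ^ (2 * (\<Sum>p\<in>A. min (floor_log p) K))" by linarith
  then have "K - 1 < 2 * (\<Sum>p\<in>A. min (floor_log p) K)" by simp
  then show ?thesis by linarith
qed

text \<open>The primes other than \<open>p\<close> have product below \<open>2 ^ K\<close> and
  contribute at most \<open>K\<close>. The prime \<open>p\<close> may be huge, and the truncation is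
  what limits it to another \<open>K\<close>.\<close>

lemma truncated_log_sum_le:
  fixes x :: real
  assumes A: "finite A" "\<And>p. p \<in> A \<Longrightarrow> prime p" and x: "x \<le> 2 ^ K"
    and p: "p \<in> A" "real (\<Prod>(A - {p})) < x"
  shows "(\<Sum>p\<in>A. min (floor_log p) K) \<le> 2 * K"
proof -
  have "2 ^ (\<Sum>q\<in>A - {p}. floor_log q) = (\<Prod>q\<in>A - {p}. 2 ^ floor_log q :: nat)"
    by (simp add: power_sum)
  also have "\<dots> \<le> \<Prod>(A - {p})"
    using A(2) by (intro prod_mono) (auto intro!: floor_log_exp2_le simp: prime_gt_0_nat)
  finally have "(2::real) ^ (\<Sum>q\<in>A - {p}. floor_log q) \<le> real (\<Prod>(A - {p}))"
    by (metis of_nat_le_iff of_nat_numeral of_nat_power)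
  with x p have "(2::real) ^ (\<Sum>q\<in>A - {p}. floor_log q) < 2 ^ K" by linarith
  then have "(\<Sum>q\<in>A - {p}. floor_log q) \<le> K" by simp
  moreover have "(\<Sum>q\<in>A - {p}. min (floor_log q) K) \<le> (\<Sum>q\<in>A - {p}. floor_log q)"
    by (intro sum_mono) simp
  moreover have "(\<Sum>q\<in>A. min (floor_log q) K) = min (floor_log p) K + (\<Sum>q\<in>A - {p}. min (floor_log q) K)"
    using A(1) p(1) by (rule sum.remove)
  ultimately show ?thesis by linarith
qed

text \<open>If a prime \<open>p\<close> is present at time \<open>x\<close> with probability
  \<open>x ^ (2 * w p)\<close> and \<open>x\<close> decreases, it leaves at rate
  \<open>2 * w p / x\<close>. From a set \<open>A\<close> with product at least \<open>M0\<close>,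
  the product drops below \<open>M0\<close> at the rate \<open>2 / x\<close> times this
  number.\<close>

definition crossing_weight :: "real \<Rightarrow> (nat \<Rightarrow> nat) \<Rightarrow> nat set \<Rightarrow> nat" where
  "crossing_weight M0 w A = (\<Sum>p\<in>{p\<in>A. real (\<Prod>(A - {p})) < M0}. w p)"

text \<open>Removing a prime does not increase the product, so the difference of indicators is 1
  exactly when the removal crosses \<open>M0\<close>, and 0 otherwise. The right side is the form in
  which Russo's formula produces the crossing rate.\<close>

lemma crossing_weight_eq_sum:
  assumes "finite A" "\<And>p. p \<in> A \<Longrightarrow> prime p"
  shows "real (crossing_weight M0 w A) * of_bool (M0 \<le> real (\<Prod>A)) =
     (\<Sum>p\<in>A. (of_bool (M0 \<le> real (\<Prod>A)) - of_bool (M0 \<le> real (\<Prod>(A - {p})))) * real (w p))"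
proof -
  have "real (\<Prod>(A - {p})) \<le> real (\<Prod>A)" if "p \<in> A" for p
  proof -
    have "\<Prod>(A - {p}) \<le> p * \<Prod>(A - {p})"
      using assms(2)[OF that] prime_ge_1_nat by simp
    then show ?thesis using prod.remove[OF assms(1) that, of "\<lambda>p. p"]
      by (simp only: of_nat_le_iff)
  qed
  then have "(of_bool (M0 \<le> real (\<Prod>A)) - of_bool (M0 \<le> real (\<Prod>(A - {p})))) * real (w p) =
     (if real (\<Prod>(A - {p})) < M0 then real (w p) * of_bool (M0 \<le> real (\<Prod>A)) else 0)" if "p \<in> A" for p
    using that by (auto simp: not_less of_bool_def dest: order_trans)
  then show ?thesis
    unfolding crossing_weight_def of_nat_sum sum_distrib_right
    by (subst sum.inter_filter[OF assms(1)]) (intro sum.cong; simp)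
qed

text \<open>Start with the primes in \<open>D\<close> and let \<open>x\<close> decrease from 1 to 0, each prime \<open>p\<close> being
  still present with probability \<open>x ^ (2 * w p)\<close>, independently. The summand for \<open>A\<close> is the density
  of the event that the product of the surviving primes drops below \<open>M0\<close> at time \<open>x\<close>,
  the last set of survivors having been \<open>A\<close>. The total probability is 1.\<close>

lemma crossing_density_riemann_sum:
  fixes M0 :: real
  assumes D: "finite D" "\<And>p. p \<in> D \<Longrightarrow> prime p" "\<And>p. p \<in> D \<Longrightarrow> 0 < w p"
    and M0: "1 < M0" "M0 \<le> real (\<Prod>D)"
  shows "(\<lambda>n. \<Sum>i<n. (\<Sum>A\<in>Pow D. of_bool (M0 \<le> real (\<Prod>A)) * (2 * real (crossing_weight M0 w A)
      * (real i / real n) ^ (2 * sum w A - 1) * (\<Prod>q\<in>D - A. 1 - (real i / real n) ^ (2 * w q)))) / real n)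
    \<longlonglongrightarrow> 1"
proof -
  define v :: "nat set \<Rightarrow> real" where "v A = of_bool (M0 \<le> real (\<Prod>A))" for A
  define G where "G u = (\<Sum>A\<in>Pow D. v A * ((\<Prod>p\<in>A. u ^ (2 * w p)) * (\<Prod>p\<in>D - A. 1 - u ^ (2 * w p))))"
    for u :: real
  define g where "g x = (\<Sum>A\<in>Pow D. of_bool (M0 \<le> real (\<Prod>A)) * (2 * real (crossing_weight M0 w A)
      * x ^ (2 * sum w A - 1) * (\<Prod>q\<in>D - A. 1 - x ^ (2 * w q))))" for x :: real
  have "(G has_real_derivative g x) (at x)" for x
  proof -
    have "((\<lambda>u. u ^ (2 * w p)) has_real_derivative real (2 * w p) * x ^ (2 * w p - 1)) (at x)" for p
      using DERIV_pow[of "2 * w p" x UNIV] by simp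
    from random_subset_has_derivative[OF D(1) this, of v]
    have "(G has_real_derivative (\<Sum>A\<in>Pow D. \<Sum>p\<in>A. (v A - v (A - {p})) *
      (real (2 * w p) * x ^ (2 * w p - 1) * (\<Prod>q\<in>A - {p}. x ^ (2 * w q)) *
      (\<Prod>q\<in>D - A. 1 - x ^ (2 * w q))))) (at x)"
      unfolding G_def[abs_def] .
    also have "(\<Sum>A\<in>Pow D. \<Sum>p\<in>A. (v A - v (A - {p})) *
      (real (2 * w p) * x ^ (2 * w p - 1) * (\<Prod>q\<in>A - {p}. x ^ (2 * w q)) *
      (\<Prod>q\<in>D - A. 1 - x ^ (2 * w q)))) = g x"
      unfolding g_def
    proof (intro sum.cong refl)
      fix A assume "A \<in> Pow D"
      then have A: "finite A" "\<And>p. p \<in> A \<Longrightarrow> prime p" "\<And>p. p \<in> A \<Longrightarrow> 0 < w p"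
        using D finite_subset by auto
      have "(\<Sum>p\<in>A. (v A - v (A - {p})) * (real (2 * w p) * x ^ (2 * w p - 1) *
          (\<Prod>q\<in>A - {p}. x ^ (2 * w q)) * (\<Prod>q\<in>D - A. 1 - x ^ (2 * w q)))) =
        (\<Sum>p\<in>A. (v A - v (A - {p})) * real (w p) *
           (2 * x ^ (2 * sum w A - 1) * (\<Prod>q\<in>D - A. 1 - x ^ (2 * w q))))"
      proof (intro sum.cong refl)
        fix p assume p: "p \<in> A"
        \<comment> \<open>The power lost by differentiating the factor at \<open>p\<close> is the
          only trace of the choice of \<open>p\<close>, so the weights can be summed over
          \<open>p\<close>. The natural subtraction is exact because \<open>0 < w p\<close>.\<close>
        have "x ^ (2 * w p - 1) * (\<Prod>q\<in>A - {p}. x ^ (2 * w q)) = x ^ (2 * sum w A - 1)"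
        proof -
          have "(\<Prod>q\<in>A - {p}. x ^ (2 * w q)) = x ^ (2 * sum w (A - {p}))"
            by (simp add: power_sum sum_distrib_left)
          moreover have "2 * sum w A - 1 = (2 * w p - 1) + 2 * sum w (A - {p})"
            using sum.remove[OF A(1) p, of w] A(3)[OF p] by simp
          ultimately show ?thesis by (simp add: power_add)
        qed
        then show "(v A - v (A - {p})) * (real (2 * w p) * x ^ (2 * w p - 1) *
          (\<Prod>q\<in>A - {p}. x ^ (2 * w q)) * (\<Prod>q\<in>D - A. 1 - x ^ (2 * w q))) =
          (v A - v (A - {p})) * real (w p) *
           (2 * x ^ (2 * sum w A - 1) * (\<Prod>q\<in>D - A. 1 - x ^ (2 * w q)))"
          by (simp add: mult.assoc)
      qed
      also have "\<dots> = real (crossing_weight M0 w A) * v A *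
           (2 * x ^ (2 * sum w A - 1) * (\<Prod>q\<in>D - A. 1 - x ^ (2 * w q)))"
      proof -
        have "real (crossing_weight M0 w A) * v A = (\<Sum>p\<in>A. (v A - v (A - {p})) * real (w p))"
          unfolding v_def by (rule crossing_weight_eq_sum) (use A in auto)
        then show ?thesis by (simp only: sum_distrib_right)
      qed
      finally show "(\<Sum>p\<in>A. (v A - v (A - {p})) * (real (2 * w p) * x ^ (2 * w p - 1) *
          (\<Prod>q\<in>A - {p}. x ^ (2 * w q)) * (\<Prod>q\<in>D - A. 1 - x ^ (2 * w q)))) =
         of_bool (M0 \<le> real (\<Prod>A)) * (2 * real (crossing_weight M0 w A)
          * x ^ (2 * sum w A - 1) * (\<Prod>q\<in>D - A. 1 - x ^ (2 * w q)))"
        by (simp add: v_def)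
    qed
    finally show ?thesis .
  qed
  moreover have "continuous_on {0..1} g"
    unfolding g_def by (intro continuous_intros)
  ultimately have "(\<lambda>n. \<Sum>i<n. g (real i / real n) / real n) \<longlonglongrightarrow> G 1 - G 0"
    by (intro left_riemann_sum_tendsto)
  \<comment> \<open>At time 1 all of \<open>D\<close> is present and its product is at least
    \<open>M0\<close>. At time 0 nothing is left, and the empty product 1 is below
    \<open>M0\<close>.\<close>
  moreover have "G 1 = 1"
  proof -
    have "(\<Prod>p\<in>D - A. 1 - 1 ^ (2 * w p)) = (of_bool (A = D) :: real)" if "A \<in> Pow D" for A
      using that D(1) by auto
    then have "G 1 = (\<Sum>A\<in>Pow D. if A = D then v A else 0)"
      unfolding G_def by (intro sum.cong) auto
    also have "\<dots> = v D" using D(1) by simp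
    finally show ?thesis using M0 by (simp add: v_def)
  qed
  moreover have "G 0 = 0"
    unfolding G_def
  proof (intro sum.neutral ballI)
    fix A assume A: "A \<in> Pow D"
    show "v A * ((\<Prod>p\<in>A. 0 ^ (2 * w p)) * (\<Prod>p\<in>D - A. 1 - 0 ^ (2 * w p))) = 0"
    proof (cases "A = {}")
      case True
      then show ?thesis using M0 by (simp add: v_def)
    next
      case False
      then obtain p where p: "p \<in> A" by auto
      then have "(0::real) ^ (2 * w p) = 0" using A D(3)[of p] by (auto simp: power_0_left)
      then have "(\<Prod>p\<in>A. (0::real) ^ (2 * w p)) = 0"
        using A D(1) p by (intro prod_zero) (auto intro: finite_subset)
      then show ?thesis by simp
    qed
  qed
  ultimately show ?thesis by (simp add: g_def)
qed

text \<open>In the crossing density, \<open>x ^ (2 * sum w A - 1)\<close> is split into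
  \<open>x ^ (m - 1)\<close>, \<open>x ^ (sum w A - m)\<close> and \<open>x ^ sum w A\<close>. The
  first goes into the weights and sums to at most \<open>1 / m\<close>, the second is bounded by 1
  and depends on \<open>l\<close> only, and the third is supplied by \<open>coprime_kernel\<close>
  along with the factors for \<open>b\<close>. Multiplication by the threshold kernel costs the
  factor \<open>I\<close>.\<close>

lemma separable_factorization_kernel:
  fixes M M0 \<epsilon> :: real and Q :: "nat set"
  assumes Q: "finite Q" "\<And>p. p \<in> Q \<Longrightarrow> prime p" and M0: "1 < M0" and M: "0 < M" and \<epsilon>: "0 < \<epsilon>"
  obtains f where "separable (\<lambda>b. 2 ^ card {p\<in>Q. p dvd b}) (8 * real I) f"
    "\<And>A B. A \<subseteq> Q \<Longrightarrow> B \<subseteq> Q \<Longrightarrow> \<Prod>A < 2 ^ I \<Longrightarrow> f (\<Prod>A) (\<Prod>B) \<noteq> 0 \<Longrightarrow>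
       A \<inter> B = {} \<and> M \<le> real (\<Prod>A * \<Prod>B) \<and> M0 \<le> real (\<Prod>A) \<and> (\<exists>p\<in>A. real (\<Prod>(A - {p})) < M0)"
    "\<And>D. D \<subseteq> Q \<Longrightarrow> \<Prod>D < 2 ^ I \<Longrightarrow> M0 \<le> real (\<Prod>D) \<Longrightarrow> M \<le> real (\<Prod>D) \<Longrightarrow>
       \<bar>1 - (\<Sum>A\<in>Pow D. f (\<Prod>A) (\<Prod>(D - A)))\<bar> < \<epsilon>"
proof -
  have subQ: "finite A" "\<forall>p\<in>A. prime p" "prime_factors (\<Prod>A) = A" "\<Prod>A dvd \<Prod>Q" "0 < \<Prod>A"
    if "A \<subseteq> Q" for A
  proof -
    show "finite A" using that Q(1) finite_subset by blast
    show "\<forall>p\<in>A. prime p" using that Q(2) by blast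
    then show "prime_factors (\<Prod>A) = A" "0 < \<Prod>A"
      using prime_factors_prod_primes[of A] prod_primes_pos[of A] \<open>finite A\<close> by simp_all
    show "\<Prod>A dvd \<Prod>Q" using that Q(1) by (rule prod_dvd_prod_subset[rotated])
  qed
  obtain K :: nat where K: "0 < K" "2 ^ (K - 1) < M0" "M0 \<le> 2 ^ K"
    using ex_ceiling_log2[OF M0] .
  define w where "w p = min (floor_log p) K" for p
  have w_pos: "0 < w p" if "p \<in> Q" for p
  proof -
    have "2 \<le> p" using Q(2)[OF that] prime_ge_2_nat by blast
    then have "0 < floor_log p" by (subst floor_log_rec) auto
    with K show ?thesis by (simp add: w_def)
  qed
  \<comment> \<open>Half of \<open>K\<close>, rounded up: the integer form of the lower bound from
    \<open>truncated_log_sum_ge\<close>.\<close>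
  define m where "m = (K + 1) div 2"
  have m: "0 < m" "K \<le> 2 * m" using K by (auto simp: m_def)
  define cw where "cw = crossing_weight M0 w"
  have sum_w_ge: "m \<le> sum w A" if "A \<subseteq> Q" "M0 \<le> real (\<Prod>A)" for A
    using truncated_log_sum_ge[of A K M0] subQ[OF that(1)] that(2) K(2)
    by (simp add: w_def[abs_def] m_def)
  have cw_le: "cw A \<le> 2 * K" if "A \<subseteq> Q" for A
  proof (cases "\<exists>p\<in>A. real (\<Prod>(A - {p})) < M0")
    case True
    then obtain p where p: "p \<in> A" "real (\<Prod>(A - {p})) < M0" by blast
    have "cw A \<le> sum w A"
      unfolding cw_def crossing_weight_def using subQ(1)[OF that] by (intro sum_mono2) auto
    also have "\<dots> \<le> 2 * K"
      using truncated_log_sum_le[of A M0 K p] subQ[OF that] p K(3) by (simp add: w_def[abs_def])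
    finally show ?thesis .
  next
    case False
    then have "cw A = 0" unfolding cw_def crossing_weight_def by (intro sum.neutral) blast
    then show ?thesis by simp
  qed
  define S where "S D n = (\<Sum>i<n. (\<Sum>A\<in>Pow D. of_bool (M0 \<le> real (\<Prod>A)) * (2 * real (cw A)
      * (real i / real n) ^ (2 * sum w A - 1) * (\<Prod>q\<in>D - A. 1 - (real i / real n) ^ (2 * w q)))) / real n)"
    for D n
  \<comment> \<open>There are only finitely many sets \<open>D\<close>, so one \<open>n\<close>
    serves all of them.\<close>
  have "\<forall>\<^sub>F n in sequentially. 0 < n \<and> (\<forall>D\<in>{D\<in>Pow Q. M0 \<le> real (\<Prod>D)}. \<bar>1 - S D n\<bar> < \<epsilon>)"
  proof (intro eventually_conj eventually_ball_finite ballI)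
    show "finite {D \<in> Pow Q. M0 \<le> real (\<Prod>D)}" using Q(1) by simp
    fix D assume D: "D \<in> {D \<in> Pow Q. M0 \<le> real (\<Prod>D)}"
    have "S D \<longlonglongrightarrow> 1"
      unfolding S_def[abs_def] cw_def
      by (rule crossing_density_riemann_sum) (use D subQ w_pos M0 in auto)
    from tendstoD[OF this \<epsilon>] show "\<forall>\<^sub>F n in sequentially. \<bar>1 - S D n\<bar> < \<epsilon>"
      by (simp add: dist_real_def abs_minus_commute)
  qed (rule eventually_gt_at_top)
  then obtain n where n: "0 < n" "\<And>D. D \<subseteq> Q \<Longrightarrow> M0 \<le> real (\<Prod>D) \<Longrightarrow> \<bar>1 - S D n\<bar> < \<epsilon>"
    unfolding eventually_sequentially by auto
  \<comment> \<open>The minimum changes nothing for \<open>i < n\<close>; it keeps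
    \<open>x i\<close> in \<open>[0,1]\<close> for every index.\<close>
  define x where "x i = min 1 (real i / real n)" for i :: nat
  have x: "0 \<le> x i" "x i \<le> 1" for i by (auto simp: x_def)
  have x_eq: "x i = real i / real n" if "i < n" for i using that by (simp add: x_def min_def)
  \<comment> \<open>Division by \<open>2 * K\<close>, the bound for \<open>cw\<close>, makes the
    coefficient at most 1.\<close>
  define a where "a i l = (if l dvd \<Prod>Q \<and> M0 \<le> real l
    then real (cw (prime_factors l)) / (2 * real K) * x i ^ (sum w (prime_factors l) - m) else 0)" for i l
  have a_le: "\<bar>a i l\<bar> \<le> 1" for i l
  proof (cases "l dvd \<Prod>Q \<and> M0 \<le> real l")
    case True
    then obtain A where A: "A \<subseteq> Q" "l = \<Prod>A" using divisors_prod_primes[of Q] Q by blast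
    have "real (cw A) / (2 * real K) \<le> 1"
      using cw_le[OF A(1)] K(1) by (simp add: divide_le_eq)
    moreover have "x i ^ (sum w A - m) \<le> 1" using x by (simp add: power_le_one)
    ultimately have "real (cw A) / (2 * real K) * x i ^ (sum w A - m) \<le> 1"
      using mult_mono[of "real (cw A) / (2 * real K)" 1 "x i ^ (sum w A - m)" 1] x by simp
    then show ?thesis using True A subQ(3)[OF A(1)] x by (simp add: a_def)
  qed (auto simp: a_def)
  obtain T where T: "separable (\<lambda>_. 1) (real I) T"
    "\<And>l b::nat. l < 2 ^ I \<Longrightarrow> 1 \<le> b \<Longrightarrow> T l b = of_bool (M \<le> real (l * b))"
    using separable_threshold[OF M, of I] by blast
  \<comment> \<open>\<open>4 * K\<close> restores the normalization \<open>2 * K\<close> and the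
    factor 2 of the density. With the bound \<open>1 / m\<close> for the sum of powers and
    \<open>K \<le> 2 * m\<close>, the total weight is at most 8.\<close>
  define c where "c i = 4 * real K * (x i ^ (m - 1) / real n)" for i
  define f where "f l b = T l b * (\<Sum>i<n. c i * (a i l * 1 * coprime_kernel Q (\<lambda>p. x i ^ w p) l b))" for l b
  have f_sep: "separable (\<lambda>b. 2 ^ card {p\<in>Q. p dvd b}) (8 * real I) f"
  proof -
    have "separable (\<lambda>b. 2 ^ card {p\<in>Q. p dvd b}) 1 (\<lambda>l b. a i l * 1 * coprime_kernel Q (\<lambda>p. x i ^ w p) l b)"
      for i
      using separable_mult_rank_one[OF separable_coprime_kernel[OF Q(1), of "\<lambda>p. x i ^ w p"],
          of "a i" "\<lambda>_. 1" "\<lambda>_. 1"] a_le x by (simp add: power_le_one)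
    then have "separable (\<lambda>b. 2 ^ card {p\<in>Q. p dvd b}) (\<Sum>i<n. c i * 1)
       (\<lambda>l b. \<Sum>i<n. c i * (a i l * 1 * coprime_kernel Q (\<lambda>p. x i ^ w p) l b))"
      using x by (intro separable_sum separable_scale) (auto simp: c_def)
    from separable_mult[OF T(1) this]
    have sep: "separable (\<lambda>b. 2 ^ card {p\<in>Q. p dvd b}) (real I * (\<Sum>i<n. c i)) f"
      by (simp add: f_def[abs_def])
    have "(\<Sum>i<n. c i) = 4 * real K * (\<Sum>i<n. (real i / real n) ^ (m - 1) / real n)"
      unfolding sum_distrib_left by (intro sum.cong) (auto simp: c_def x_eq)
    also have "\<dots> \<le> 4 * real K * (1 / real m)"
      by (intro mult_left_mono sum_left_endpoints_power_le m) simp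
    also have "\<dots> \<le> 8" using m by (simp add: divide_le_eq)
    finally have "real I * (\<Sum>i<n. c i) \<le> 8 * real I"
      using mult_left_mono[of "\<Sum>i<n. c i" 8 "real I"] by simp
    from separable_mono[OF sep this] show ?thesis by simp
  qed
  have f_eq: "f (\<Prod>A) (\<Prod>B) = of_bool (M \<le> real (\<Prod>A * \<Prod>B)) * (of_bool (A \<inter> B = {}) *
     (\<Sum>i<n. of_bool (M0 \<le> real (\<Prod>A)) * (2 * real (cw A) * (real i / real n) ^ (2 * sum w A - 1) *
        (\<Prod>q\<in>B. 1 - (real i / real n) ^ (2 * w q))) / real n))"
    if AB: "A \<subseteq> Q" "B \<subseteq> Q" "\<Prod>A < 2 ^ I" for A B
  proof -
    have key: "c i * (a i (\<Prod>A) * 1 * coprime_kernel Q (\<lambda>p. x i ^ w p) (\<Prod>A) (\<Prod>B)) =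
      of_bool (A \<inter> B = {}) * (of_bool (M0 \<le> real (\<Prod>A)) * (2 * real (cw A) * x i ^ (2 * sum w A - 1) *
        (\<Prod>q\<in>B. 1 - x i ^ (2 * w q))) / real n)" for i
    proof (cases "A \<inter> B = {} \<and> M0 \<le> real (\<Prod>A)")
      case True
      have "coprime_kernel Q (\<lambda>p. x i ^ w p) (\<Prod>A) (\<Prod>B) = x i ^ sum w A * (\<Prod>q\<in>B. 1 - x i ^ (2 * w q))"
        using coprime_kernel_prod_primes[of Q A B "\<lambda>p. x i ^ w p"] Q AB True
        by (simp add: power_sum power_mult[symmetric] mult.commute)
      moreover have "c i * a i (\<Prod>A) = 2 * real (cw A) * (x i ^ (m - 1) * x i ^ (sum w A - m)) / real n"
        using True subQ[OF AB(1)] K(1) by (simp add: a_def c_def)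
      moreover have "2 * sum w A - 1 = (m - 1) + (sum w A - m) + sum w A"
        using sum_w_ge[OF AB(1)] True m(1) by simp
      then have "x i ^ (2 * sum w A - 1) = x i ^ (m - 1) * x i ^ (sum w A - m) * x i ^ sum w A"
        by (simp only: power_add)
      ultimately show ?thesis using True by (simp add: mult.assoc[symmetric])
    next
      case False
      then show ?thesis
        using coprime_kernel_prod_primes[of Q A B "\<lambda>p. x i ^ w p"] Q AB by (auto simp: a_def)
    qed
    have T_eq: "T (\<Prod>A) (\<Prod>B) = of_bool (M \<le> real (\<Prod>A * \<Prod>B))"
      by (rule T(2)) (use AB subQ(5)[OF AB(2)] in auto)
    show ?thesis
      unfolding f_def T_eq sum_distrib_left[of "of_bool (A \<inter> B = {})"]
      by (rule arg_cong2[where f = "(*)", OF refl], rule sum.cong[OF refl])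
        (subst key, simp only: x_eq lessThan_iff)
  qed
  show ?thesis
  proof (rule that[OF f_sep])
    fix A B assume AB: "A \<subseteq> Q" "B \<subseteq> Q" "\<Prod>A < 2 ^ I" and "f (\<Prod>A) (\<Prod>B) \<noteq> 0"
    then have nz: "A \<inter> B = {}" "M \<le> real (\<Prod>A * \<Prod>B)"
      "(\<Sum>i<n. of_bool (M0 \<le> real (\<Prod>A)) * (2 * real (cw A) * (real i / real n) ^ (2 * sum w A - 1) *
        (\<Prod>q\<in>B. 1 - (real i / real n) ^ (2 * w q))) / real n) \<noteq> 0"
      using f_eq[OF AB] by (auto simp only: mult_eq_0_iff of_bool_eq_0_iff)
    from nz(3) have nz': "M0 \<le> real (\<Prod>A)" "cw A \<noteq> 0"
      by (auto intro: ccontr)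
    have "\<exists>p\<in>A. real (\<Prod>(A - {p})) < M0"
      using nz'(2) unfolding cw_def crossing_weight_def by (metis (no_types, lifting) sum.neutral mem_Collect_eq)
    with nz nz' show "A \<inter> B = {} \<and> M \<le> real (\<Prod>A * \<Prod>B) \<and> M0 \<le> real (\<Prod>A) \<and>
        (\<exists>p\<in>A. real (\<Prod>(A - {p})) < M0)" by blast
  next
    fix D assume D: "D \<subseteq> Q" "\<Prod>D < 2 ^ I" "M0 \<le> real (\<Prod>D)" "M \<le> real (\<Prod>D)"
    have "(\<Sum>A\<in>Pow D. f (\<Prod>A) (\<Prod>(D - A))) = (\<Sum>A\<in>Pow D. \<Sum>i<n. of_bool (M0 \<le> real (\<Prod>A)) *
       (2 * real (cw A) * (real i / real n) ^ (2 * sum w A - 1) *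
        (\<Prod>q\<in>D - A. 1 - (real i / real n) ^ (2 * w q))) / real n)"
    proof (intro sum.cong refl)
      fix A assume A: "A \<in> Pow D"
      have AQ: "A \<subseteq> Q" "D - A \<subseteq> Q" using A D by auto
      have prod: "\<Prod>A * \<Prod>(D - A) = \<Prod>D"
        using prod.subset_diff[of A D "\<lambda>p. p"] A subQ(1)[OF D(1)] by (simp add: mult.commute)
      have "\<Prod>A \<le> \<Prod>D"
        using subQ(5)[OF D(1)] prod by (metis dvd_imp_le dvd_triv_left)
      then show "f (\<Prod>A) (\<Prod>(D - A)) = (\<Sum>i<n. of_bool (M0 \<le> real (\<Prod>A)) *
       (2 * real (cw A) * (real i / real n) ^ (2 * sum w A - 1) *
        (\<Prod>q\<in>D - A. 1 - (real i / real n) ^ (2 * w q))) / real n)"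
        using f_eq[of A "D - A"] A D prod AQ by (simp del: of_nat_prod)
    qed
    also have "\<dots> = S D n"
      unfolding S_def sum_divide_distrib by (rule sum.swap)
    finally show "\<bar>1 - (\<Sum>A\<in>Pow D. f (\<Prod>A) (\<Prod>(D - A)))\<bar> < \<epsilon>"
      using n(2)[OF D(1,3)] by simp
  qed
qed

section \<open>Ramare's identity\<close>

lemma finite_primes_below: "finite {p\<in>P. real p < y}"
proof (rule finite_subset)
  show "{p\<in>P. real p < y} \<subseteq> {..nat \<lceil>y\<rceil>}" by (auto simp: le_nat_iff ceiling_le_iff intro: less_imp_le) linarith
qed simp

lemma coprime_prime_product_iff:
  assumes "\<And>p. p \<in> P \<Longrightarrow> prime p"
  shows "coprime n (prime_product P y) \<longleftrightarrow> (\<forall>p\<in>P. real p < y \<longrightarrow> \<not> p dvd n)"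
  unfolding prime_product_def
  using coprime_prod_primes_iff[OF finite_primes_below, of P y n] assms by auto

definition ramare_exceptional :: "nat set \<Rightarrow> real \<Rightarrow> real \<Rightarrow> nat \<Rightarrow> bool" where
  "ramare_exceptional P z Z n \<longleftrightarrow>
     (\<exists>q\<in>P. real q = Z \<and> q dvd n) \<or> (\<exists>p\<in>P. z \<le> real p \<and> p\<^sup>2 dvd n)"

text \<open>The primes \<open>p \<in> [z,Z]\<close> counted by \<open>rho\<close> include \<open>p = Z\<close>, which
  the sum over \<open>p\<close> excludes; together with \<open>p\<^sup>2 dvd n\<close> this is the only source of error.\<close>

lemma ramare_weights:
  assumes P: "\<And>p. p \<in> P \<Longrightarrow> prime p" and z: "z \<le> Z" and n: "0 < n"
  defines "e \<equiv> of_bool (coprime n (prime_product P Z)) - of_bool (coprime n (prime_product P z))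
     + (\<Sum>p\<in>{p\<in>P. z \<le> real p \<and> real p < Z \<and> p dvd n}. rho P z Z (n div p))"
  shows "\<bar>e\<bar> \<le> of_bool (ramare_exceptional P z Z n)"
proof -
  define S where "S = {p\<in>P. z \<le> real p \<and> real p < Z \<and> p dvd n}"
  define S' where "S' = {p\<in>P. z \<le> real p \<and> real p \<le> Z \<and> p dvd n}"
  define R where "R p = {q\<in>P. z \<le> real q \<and> real q \<le> Z \<and> q dvd (n div p)}" for p
  have fin: "finite S" "finite S'"
    using finite_divisors_nat[OF n] by (auto simp: S_def S'_def intro: finite_subset[rotated])
  have sub: "S \<subseteq> S'" by (auto simp: S_def S'_def)
  show ?thesis
  proof (cases "coprime n (prime_product P z)")
    case False
    then obtain q where q: "q \<in> P" "real q < z" "q dvd n"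
      using coprime_prime_product_iff[OF P] by auto
    have "\<not> coprime n (prime_product P Z)"
      using q z coprime_prime_product_iff[OF P, where n = n and y = Z] by force
    \<comment> \<open>The small prime \<open>q\<close> differs from \<open>p\<close>, so it still
      divides \<open>n div p\<close>.\<close>
    moreover have "rho P z Z (n div p) = 0" if "p \<in> S" for p
    proof -
      have p: "p \<in> P" "z \<le> real p" "p dvd n" using that by (auto simp: S_def)
      have "q \<noteq> p" using q p by auto
      then have "\<not> q dvd p" using primes_dvd_imp_eq[of q p] P q p by auto
      moreover have "q dvd p * (n div p)" using q p by simp
      ultimately have "q dvd n div p" using prime_dvd_mult_iff[of q p "n div p"] P[OF q(1)] by blast
      then have "\<not> coprime (n div p) (prime_product P z)"
        using q coprime_prime_product_iff[OF P, where n = "n div p" and y = z] by blast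
      then show ?thesis by (simp add: rho_def)
    qed
    ultimately have "e = 0" using False by (simp add: e_def S_def[symmetric])
    then show ?thesis by simp
  next
    case True
    have rho: "rho P z Z (n div p) = 1 / (1 + real (card (R p)))" if "p \<in> S" for p
    proof -
      have "n div p dvd n" using that by (auto simp: S_def)
      then have "coprime (n div p) (prime_product P z)" using coprime_divisors[OF _ dvd_refl True] by simp
      then show ?thesis by (simp add: rho_def R_def)
    qed
    \<comment> \<open>Passing from \<open>n\<close> to \<open>n div p\<close> can lose only the
      prime \<open>p\<close> itself. Hence \<open>1 + card (R p) \<ge> card S\<close>, and the
      weights over \<open>S\<close> add up to at most 1.\<close>
    have R_sub: "R p \<subseteq> S'" "S' - {p} \<subseteq> R p" if p: "p \<in> S" for p
    proof -
      have n_eq: "n = p * (n div p)" using p by (auto simp: S_def)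
      have "n div p dvd n" using p by (auto simp: S_def)
      then show "R p \<subseteq> S'" by (auto simp: R_def S'_def intro: dvd_trans)
      show "S' - {p} \<subseteq> R p"
      proof
        fix q assume q: "q \<in> S' - {p}"
        then have "\<not> q dvd p" using primes_dvd_imp_eq[of q p] P p by (auto simp: S_def S'_def)
        moreover have "q dvd p * (n div p)" using q n_eq by (auto simp: S'_def)
        ultimately have "q dvd n div p"
          using prime_dvd_mult_iff[of q p "n div p"] P q by (auto simp: S'_def)
        then show "q \<in> R p" using q by (auto simp: R_def S'_def)
      qed
    qed
    have S_empty: "coprime n (prime_product P Z) \<longleftrightarrow> S = {}"
      using True coprime_prime_product_iff[OF P] by (force simp: S_def)
    have e_eq: "e = of_bool (S = {}) - 1 + (\<Sum>p\<in>S. 1 / (1 + real (card (R p))))"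
      using True rho by (simp add: e_def S_empty S_def[symmetric])
    show ?thesis
    proof (cases "S = {}")
      case False
      have "0 \<le> (\<Sum>p\<in>S. 1 / (1 + real (card (R p))))" by (intro sum_nonneg) simp
      moreover have "(\<Sum>p\<in>S. 1 / (1 + real (card (R p)))) \<le> (\<Sum>p\<in>S. 1 / real (card S))"
      proof (rule sum_mono)
        fix p assume p: "p \<in> S"
        have "card S \<le> card S'" using sub fin by (intro card_mono)
        also have "card S' = Suc (card (S' - {p}))" using p sub fin by (intro card.remove) auto
        also have "card (S' - {p}) \<le> card (R p)"
          using R_sub[OF p] fin by (intro card_mono) (auto intro: finite_subset)
        finally have "real (card S) \<le> 1 + real (card (R p))" by simp
        moreover have "0 < card S" using fin False by (simp add: card_gt_0_iff)
        ultimately show "1 / (1 + real (card (R p))) \<le> 1 / real (card S)"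
          by (intro divide_left_mono) auto
      qed
      moreover have "(\<Sum>p\<in>S. 1 / real (card S)) = 1" using False fin by simp
      ultimately have "\<bar>e\<bar> \<le> 1" using False by (simp add: e_eq)
      \<comment> \<open>Without exceptions \<open>S' = S\<close> and \<open>p\<close> does not
        divide \<open>n div p\<close>, so each of the \<open>card S\<close> weights is exactly
        \<open>1 / card S\<close>.\<close>
      moreover have "e = 0" if ne: "\<not> ramare_exceptional P z Z n"
      proof -
        have "S' = S" using ne by (force simp: ramare_exceptional_def S_def S'_def)
        have "1 + real (card (R p)) = real (card S)" if p: "p \<in> S" for p
        proof -
          have "p \<notin> R p"
          proof
            assume "p \<in> R p"
            then have "p * p dvd p * (n div p)" by (intro mult_dvd_mono) (auto simp: R_def)
            moreover have "p * (n div p) = n" using p by (simp add: S_def)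
            ultimately have "p\<^sup>2 dvd n" by (simp only: power2_eq_square)
            then show False using ne p by (auto simp: ramare_exceptional_def S_def)
          qed
          then have "R p = S - {p}" using R_sub[OF p] \<open>S' = S\<close> by auto
          moreover have "card S = Suc (card (S - {p}))" using p fin by (intro card.remove) auto
          ultimately show ?thesis by simp
        qed
        then show ?thesis using False fin by (simp add: e_eq)
      qed
      ultimately show ?thesis by auto
    qed (simp add: e_eq)
  qed
qed

section \<open>Counting the exceptional integers\<close>

lemma card_multiples_le:
  assumes "0 < d"
  shows "real (card {n\<in>{1..N}. d dvd n}) \<le> real N / real d"
proof -
  have "{n\<in>{1..N}. d dvd n} \<subseteq> (\<lambda>k. d * k) ` {1..N div d}"
  proof
    fix n assume n: "n \<in> {n\<in>{1..N}. d dvd n}"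
    then obtain k where k: "n = d * k" by auto
    then have "k \<in> {1..N div d}"
      using n assms by (auto simp: less_eq_div_iff_mult_less_eq mult.commute Suc_le_eq)
    then show "n \<in> (\<lambda>k. d * k) ` {1..N div d}" using k by blast
  qed
  then have "card {n\<in>{1..N}. d dvd n} \<le> N div d"
    using surj_card_le[of "{1..N div d}"] by fastforce
  then have "real (card {n\<in>{1..N}. d dvd n}) \<le> real (N div d)" by simp
  also have "\<dots> \<le> real N / real d" by (rule of_nat_div_le_of_nat)
  finally show ?thesis .
qed

text \<open>Telescoping, from \<open>1 / p\<^sup>2 \<le> 1 / (p - 1) - 1 / p\<close>.\<close>

lemma sum_inverse_squares_le:
  fixes k :: nat
  assumes "2 \<le> k"
  shows "(\<Sum>p\<in>{k..<k + j}. 1 / (real p)\<^sup>2) \<le> 1 / (real k - 1) - 1 / (real (k + j) - 1)"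
proof (induction j)
  case (Suc j)
  let ?x = "real (k + j)"
  have x: "1 < ?x" using assms by simp
  have "1 / ?x\<^sup>2 \<le> 1 / (?x * (?x - 1))"
    using x by (intro divide_left_mono) (auto simp: power2_eq_square intro!: mult_left_mono)
  also have "\<dots> = 1 / (?x - 1) - 1 / ?x"
    using x by (simp add: diff_frac_eq)
  finally have "1 / ?x\<^sup>2 \<le> 1 / (?x - 1) - 1 / ?x" .
  with Suc show ?case by simp
qed simp

text \<open>The multiples of \<open>Z\<close> number at most \<open>N / Z \<le> N / z\<close>. The
  multiples of squares are bounded by a union over all integers from \<open>max 2 z\<close> on,
  whose inverse squares sum to at most \<open>2 / z\<close>.\<close>

lemma card_ramare_exceptional_le:
  assumes P: "\<And>p. p \<in> P \<Longrightarrow> prime p" and z: "0 < z" "z \<le> Z"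
  shows "real (card {n\<in>{1..N}. ramare_exceptional P z Z n}) \<le> 3 * (real N / z)"
proof -
  \<comment> \<open>The lower limit 2 keeps \<open>k - 1\<close> positive for small \<open>z\<close>
    and gives \<open>1 / (k - 1) \<le> 2 / k\<close>.\<close>
  define k where "k = max 2 (nat \<lceil>z\<rceil>)"
  have k: "2 \<le> k" "z \<le> real k" by (auto simp: k_def) linarith
  let ?A = "{n\<in>{1..N}. \<exists>q\<in>P. real q = Z \<and> q dvd n}"
  let ?B = "\<Union>p\<in>{k..<k + N}. {n\<in>{1..N}. p\<^sup>2 dvd n}"
  have "{n\<in>{1..N}. ramare_exceptional P z Z n} \<subseteq> ?A \<union> ?B"
  proof
    fix n assume n: "n \<in> {n\<in>{1..N}. ramare_exceptional P z Z n}"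
    show "n \<in> ?A \<union> ?B"
    proof (cases "n \<in> ?A")
      case False
      then obtain p where p: "p \<in> P" "z \<le> real p" "p\<^sup>2 dvd n"
        using n by (auto simp: ramare_exceptional_def)
      have "2 \<le> p" using P[OF p(1)] prime_ge_2_nat by blast
      moreover have "nat \<lceil>z\<rceil> \<le> p" using p(2) by linarith
      moreover have "p \<le> n"
        using p(3) n \<open>2 \<le> p\<close> by (auto dest!: dvd_imp_le simp: power2_eq_square) (metis le_square le_trans)
      ultimately have "p \<in> {k..<k + N}" using n k(1) by (auto simp: k_def)
      then show ?thesis using p(3) n by auto
    qed auto
  qed
  then have "card {n\<in>{1..N}. ramare_exceptional P z Z n} \<le> card (?A \<union> ?B)"
    by (intro card_mono) auto
  also have "\<dots> \<le> card ?A + card ?B" by (rule card_Un_le)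
  finally have "real (card {n\<in>{1..N}. ramare_exceptional P z Z n}) \<le> real (card ?A) + real (card ?B)"
    by linarith
  moreover have "real (card ?A) \<le> real N / z"
  proof (cases "\<exists>q\<in>P. real q = Z")
    case True
    then obtain q where q: "q \<in> P" "real q = Z" by auto
    then have "?A = {n\<in>{1..N}. q dvd n}" by auto
    then have "real (card ?A) \<le> real N / real q"
      using card_multiples_le[of q N] P[OF q(1)] prime_gt_0_nat by simp
    also have "\<dots> \<le> real N / z" using q z by (intro divide_left_mono) auto
    finally show ?thesis .
  next
    case False
    then have "card ?A = 0" by (subst card_eq_0_iff) auto
    then show ?thesis using z by (simp only: of_nat_0 divide_nonneg_pos of_nat_0_le_iff)
  qed
  moreover have "real (card ?B) \<le> 2 * (real N / z)"
  proof -
    have "card ?B \<le> (\<Sum>p\<in>{k..<k + N}. card {n\<in>{1..N}. p\<^sup>2 dvd n})"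
      by (rule card_UN_le) simp
    then have "real (card ?B) \<le> (\<Sum>p\<in>{k..<k + N}. real (card {n\<in>{1..N}. p\<^sup>2 dvd n}))"
      unfolding of_nat_sum[symmetric] of_nat_le_iff .
    also have "\<dots> \<le> (\<Sum>p\<in>{k..<k + N}. real N * (1 / (real p)\<^sup>2))"
    proof (rule sum_mono)
      fix p assume "p \<in> {k..<k + N}"
      then show "real (card {n\<in>{1..N}. p\<^sup>2 dvd n}) \<le> real N * (1 / (real p)\<^sup>2)"
        using card_multiples_le[of "p\<^sup>2" N] k by simp
    qed
    also have "\<dots> = real N * (\<Sum>p\<in>{k..<k + N}. 1 / (real p)\<^sup>2)" by (simp add: sum_distrib_left)
    also have "\<dots> \<le> real N * (2 / z)"
    proof (rule mult_left_mono)
      have "(\<Sum>p\<in>{k..<k + N}. 1 / (real p)\<^sup>2) \<le> 1 / (real k - 1) - 1 / (real (k + N) - 1)"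
        by (rule sum_inverse_squares_le[OF k(1)])
      also have "\<dots> \<le> 1 / (real k - 1)" using k by simp
      also have "\<dots> \<le> 2 / real k" using k by (simp add: field_simps)
      also have "\<dots> \<le> 2 / z" using k z by (intro divide_left_mono) auto
      finally show "(\<Sum>p\<in>{k..<k + N}. 1 / (real p)\<^sup>2) \<le> 2 / z" .
    qed simp
    finally show ?thesis by (simp add: mult.commute)
  qed
  ultimately show ?thesis by linarith
qed

section \<open>The bilinear form\<close>

lemma moebius_mu_abs_le: "\<bar>moebius_mu n\<bar> \<le> 1"
  by (simp add: moebius_mu_def)

text \<open>Rescaling of time; the length \<open>C\<close> of the interval moves into the second
  factor.\<close>

lemma separable_has_integral_unit:
  fixes f :: "'a \<Rightarrow> 'b \<Rightarrow> real"
  assumes "separable \<phi> C f" and nonneg: "\<And>b. 0 \<le> \<phi> b" and C: "0 < C"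
  obtains a :: "real \<Rightarrow> 'a \<Rightarrow> real" and c :: "real \<Rightarrow> 'b \<Rightarrow> real"
    where "\<And>t l. \<bar>a t l\<bar> \<le> 1" "\<And>t b. \<bar>c t b\<bar> \<le> C * \<phi> b"
    "\<And>l b. ((\<lambda>t. a t l * c t b) has_integral f l b) {0..1}"
proof -
  obtain a c where ac: "\<And>t l. \<bar>a t l\<bar> \<le> 1" "\<And>t b. \<bar>c t b\<bar> \<le> \<phi> b"
    "\<And>l b. ((\<lambda>t. a t l * c t b) has_integral f l b) {0..C}"
    using separable_has_integral[OF assms(1)] nonneg by blast
  have "((\<lambda>t. a (C * t) l * (C * c (C * t) b)) has_integral f l b) {0..1}" for l b
  proof -
    have "((\<lambda>t. a (C * t) l * c (C * t) b) has_integral f l b / C) {0..1}"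
      using has_integral_affinity'[of "\<lambda>t. a t l * c t b" "f l b" 0 C C 0] ac(3)[of l b] C
      by (simp add: divide_inverse mult.commute)
    from has_integral_mult_right[OF this, of C] show ?thesis
      using C by (simp add: mult_ac)
  qed
  with that[of "\<lambda>t. a (C * t)" "\<lambda>t b. C * c (C * t) b"] ac C show ?thesis
    by (simp add: abs_mult)
qed

text \<open>A term with \<open>b dvd k\<close> and \<open>k * l = n\<close> corresponds to the
  divisor \<open>l * b\<close> of \<open>n\<close> with a chosen factor \<open>l\<close>, that is,
  to a set \<open>D\<close> of primes with a subset \<open>A\<close>. The support of
  \<open>f\<close> makes \<open>l\<close> and \<open>b\<close> coprime, so their Moebius values
  multiply to that of \<open>\<Prod>D\<close>, and it forces \<open>l\<close> into the required
  range.\<close>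

lemma sum_bilinear_coefficients:
  fixes M M0 z :: real and f :: "nat \<Rightarrow> nat \<Rightarrow> real"
  assumes Q: "finite Q" "\<And>p. p \<in> Q \<Longrightarrow> prime p" "\<And>p. p \<in> Q \<Longrightarrow> real p < z"
    and f: "\<And>A B. A \<subseteq> Q \<Longrightarrow> B \<subseteq> Q \<Longrightarrow> \<Prod>A \<le> n \<Longrightarrow> f (\<Prod>A) (\<Prod>B) \<noteq> 0 \<Longrightarrow>
       A \<inter> B = {} \<and> M \<le> real (\<Prod>A * \<Prod>B) \<and> M0 \<le> real (\<Prod>A) \<and> (\<exists>p\<in>A. real (\<Prod>(A - {p})) < M0)"
    and n: "0 < n"
  shows "(\<Sum>(k, l)\<in>{(k, l). 1 \<le> k \<and> 1 \<le> l \<and> M \<le> real (k * l) \<and> k * l = n \<and> M0 \<le> real l \<and> real l \<le> M0 * z}.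
       \<Sum>b\<in>{b. b dvd k \<and> b dvd \<Prod>Q}. of_bool (l dvd \<Prod>Q) * (of_int (moebius_mu l) * of_int (moebius_mu b) * f l b)) =
     (\<Sum>D\<in>{D\<in>Pow Q. \<Prod>D dvd n \<and> M \<le> real (\<Prod>D)}. of_int (moebius_mu (\<Prod>D)) *
        (\<Sum>A\<in>Pow D. f (\<Prod>A) (\<Prod>(D - A))))"
proof -
  have subQ: "finite A" "\<forall>p\<in>A. prime p" "prime_factors (\<Prod>A) = A" "\<Prod>A dvd \<Prod>Q" "0 < \<Prod>A"
    "moebius_mu (\<Prod>A) = (-1) ^ card A" if "A \<subseteq> Q" for A
  proof -
    show "finite A" using that Q(1) finite_subset by blast
    show "\<forall>p\<in>A. prime p" using that Q(2) by blast
    then show "prime_factors (\<Prod>A) = A" "0 < \<Prod>A" "moebius_mu (\<Prod>A) = (-1) ^ card A"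
      using prime_factors_prod_primes[of A] prod_primes_pos[of A] moebius_mu_prod_primes[of A]
        \<open>finite A\<close> by simp_all
    show "\<Prod>A dvd \<Prod>Q" using that Q(1) by (rule prod_dvd_prod_subset[rotated])
  qed
  have divE: "\<exists>A\<subseteq>Q. l = \<Prod>A" if "l dvd \<Prod>Q" for l
    using divisors_prod_primes[of Q] Q that by blast
  let ?X = "{(k, l). 1 \<le> k \<and> 1 \<le> l \<and> M \<le> real (k * l) \<and> k * l = n \<and> M0 \<le> real l \<and> real l \<le> M0 * z}"
  let ?Y = "{D\<in>Pow Q. \<Prod>D dvd n \<and> M \<le> real (\<Prod>D)}"
  let ?S = "SIGMA kl:?X. {b. b dvd fst kl \<and> b dvd \<Prod>Q}"
  let ?T = "SIGMA D:?Y. Pow D"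
  define g where "g = (\<lambda>((k::nat, l), b). of_bool (l dvd \<Prod>Q) * (of_int (moebius_mu l) * of_int (moebius_mu b) * f l b))"
  define h where "h = (\<lambda>(D, A). of_int (moebius_mu (\<Prod>D)) * f (\<Prod>A) (\<Prod>(D - A)))"
  define j where "j = (\<lambda>((k::nat, l::nat), b::nat). (prime_factors l \<union> prime_factors b, prime_factors l))"
  define i where "i = (\<lambda>(D::nat set, A). ((n div \<Prod>A, \<Prod>A), \<Prod>(D - A)))"
  have "?X \<subseteq> {..n} \<times> {..n}" by auto
  then have finX: "finite ?X" by (rule finite_subset) simp
  have fin_dvd: "finite {b. b dvd k \<and> b dvd \<Prod>Q}" for k
    using subQ(5)[OF order_refl] by (auto intro: finite_subset[OF _ finite_divisors_nat])
  have finY: "finite ?Y" "\<forall>D\<in>?Y. finite (Pow D)" using Q(1) finite_subset by auto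
  have "(\<Sum>(k, l)\<in>?X. \<Sum>b\<in>{b. b dvd k \<and> b dvd \<Prod>Q}.
      of_bool (l dvd \<Prod>Q) * (of_int (moebius_mu l) * of_int (moebius_mu b) * f l b)) = (\<Sum>x\<in>?S. g x)"
    using sum.Sigma[of ?X "\<lambda>kl. {b. b dvd fst kl \<and> b dvd \<Prod>Q}" "\<lambda>kl b. g (kl, b)"] finX fin_dvd
    by (simp add: g_def case_prod_unfold)
  also have "\<dots> = (\<Sum>x\<in>{x\<in>?S. g x \<noteq> 0}. g x)"
    using finX fin_dvd by (intro sum.mono_neutral_right finite_SigmaI) auto
  \<comment> \<open>The correspondence is bijective only between the nonzero terms: elsewhere
    \<open>l\<close> and \<open>b\<close> may share primes, or \<open>\<Prod>A\<close> may leave the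
    range of \<open>l\<close>.\<close>
  also have "\<dots> = (\<Sum>y\<in>{y\<in>?T. h y \<noteq> 0}. h y)"
  proof (rule sum.reindex_bij_witness[where i = i and j = j])
    fix x assume x: "x \<in> {x\<in>?S. g x \<noteq> 0}"
    obtain k l b where klb: "x = ((k, l), b)" by (metis surj_pair)
    have kl: "k * l = n" "b dvd k" "b dvd \<Prod>Q" "l dvd \<Prod>Q" "f l b \<noteq> 0"
      using x by (auto simp: klb g_def)
    obtain A B where AB: "A \<subseteq> Q" "l = \<Prod>A" "B \<subseteq> Q" "b = \<Prod>B" using divE kl by metis
    have "l \<le> n" using kl(1) n by (auto intro: dvd_imp_le)
    then have fAB: "A \<inter> B = {}" "M \<le> real (\<Prod>A * \<Prod>B)" using f[of A B] AB kl(5) by auto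
    have pf: "prime_factors l = A" "prime_factors b = B" using subQ(3) AB by auto
    have fin: "finite A" "finite B" using subQ(1) AB by auto
    have prodD: "\<Prod>(A \<union> B) = l * b" using fAB fin AB by (simp add: prod.union_disjoint)
    have diff: "A \<union> B - A = B" using fAB by auto
    have div: "n div \<Prod>A = k" using kl(1) subQ(5)[OF AB(1)] AB(2) by (metis nonzero_mult_div_cancel_right less_not_refl)
    have jx: "j x = (A \<union> B, A)" by (simp add: j_def klb pf)
    show "i (j x) = x"
      unfolding jx by (simp add: i_def klb diff div) (simp add: AB)
    have "moebius_mu (\<Prod>(A \<union> B)) = moebius_mu l * moebius_mu b"
      using subQ(6)[of "A \<union> B"] subQ(6)[OF AB(1)] subQ(6)[OF AB(3)] AB fAB fin
      by (simp add: card_Un_disjoint power_add)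
    then have hg: "h (A \<union> B, A) = g x"
      using kl by (simp add: h_def g_def klb diff AB(2,4)[symmetric])
    then show "h (j x) = g x" by (simp add: jx)
    have "l * b dvd n" using kl(1,2) by (metis mult.commute mult_dvd_mono dvd_refl)
    then have "(A \<union> B, A) \<in> ?T" using AB fAB prodD by (auto simp del: of_nat_prod of_nat_mult)
    then show "j x \<in> {y\<in>?T. h y \<noteq> 0}"
      using x hg by (simp add: jx)
  next
    fix y assume y: "y \<in> {y\<in>?T. h y \<noteq> 0}"
    obtain D A where DA: "y = (D, A)" by (metis surj_pair)
    have D: "D \<subseteq> Q" "\<Prod>D dvd n" "M \<le> real (\<Prod>D)" "A \<subseteq> D" "f (\<Prod>A) (\<Prod>(D - A)) \<noteq> 0"
      using y by (auto simp: DA h_def)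
    then have AQ: "A \<subseteq> Q" "D - A \<subseteq> Q" by auto
    have prod: "\<Prod>A * \<Prod>(D - A) = \<Prod>D"
      using prod.subset_diff[of A D "\<lambda>p. p"] D(4) subQ(1)[OF D(1)] by (simp add: mult.commute)
    have An: "\<Prod>A dvd n" using prod D(2) by (metis dvd_mult_left)
    have "\<Prod>A \<le> n" using An n by (rule dvd_imp_le)
    then obtain p where p: "M0 \<le> real (\<Prod>A)" "p \<in> A" "real (\<Prod>(A - {p})) < M0"
      using f[OF AQ] D(5) by blast
    \<comment> \<open>Without its last crossing prime \<open>p < z\<close> the product is below
      \<open>M0\<close>; this is the source of the upper limit \<open>M0 * z\<close>.\<close>
    have "real (\<Prod>A) = real (\<Prod>(A - {p})) * real p"
      using prod.remove[OF subQ(1)[OF AQ(1)] p(2), of "\<lambda>p. p"] by (simp only: of_nat_mult mult.commute)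
    also have "\<dots> \<le> M0 * z"
      using p(2,3) Q(3)[of p] AQ(1) by (intro mult_mono) (auto simp del: of_nat_prod)
    finally have upper: "real (\<Prod>A) \<le> M0 * z" .
    have pf: "prime_factors (\<Prod>A) = A" "prime_factors (\<Prod>(D - A)) = D - A" using subQ(3) AQ by auto
    have iy: "i y = ((n div \<Prod>A, \<Prod>A), \<Prod>(D - A))" by (simp add: i_def DA)
    show "j (i y) = y"
      unfolding iy using pf D(4) by (auto simp: j_def DA)
    have "moebius_mu (\<Prod>D) = moebius_mu (\<Prod>A) * moebius_mu (\<Prod>(D - A))"
    proof -
      have "card D = card A + card (D - A)"
        using card_Un_disjoint[of A "D - A"] subQ(1)[OF AQ(1)] subQ(1)[OF AQ(2)] D(4)
        by (simp add: Un_absorb1)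
      then show ?thesis using subQ(6) AQ D(1) by (simp add: power_add)
    qed
    then have hg: "g ((n div \<Prod>A, \<Prod>A), \<Prod>(D - A)) = h y"
      using subQ(4)[OF AQ(1)] by (simp add: g_def h_def DA)
    have "\<Prod>A * \<Prod>(D - A) dvd \<Prod>A * (n div \<Prod>A)" using prod D(2) An by simp
    then have Bdvd: "\<Prod>(D - A) dvd n div \<Prod>A" using subQ(5)[OF AQ(1)] by simp
    have "\<Prod>D \<le> n" using D(2) n by (rule dvd_imp_le)
    then have "M \<le> real n" using D(3) by linarith
    moreover have "0 < n div \<Prod>A" using An n \<open>\<Prod>A \<le> n\<close> subQ(5)[OF AQ(1)] by (simp add: div_greater_zero_iff)
    ultimately have "((n div \<Prod>A, \<Prod>A), \<Prod>(D - A)) \<in> ?S"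
      using An p(1) upper Bdvd subQ(4)[OF AQ(2)] subQ(5)[OF AQ(1)] by (simp add: Suc_le_eq del: of_nat_prod of_nat_mult)
    then show "i y \<in> {x\<in>?S. g x \<noteq> 0}"
      using y hg by (simp add: iy)
  qed
  also have "\<dots> = (\<Sum>y\<in>?T. h y)"
  proof (rule sum.mono_neutral_left)
    show "finite ?T" by (rule finite_SigmaI[OF finY(1)]) (use finY(2) in blast)
  qed blast+
  also have "\<dots> = (\<Sum>D\<in>?Y. \<Sum>A\<in>Pow D. h (D, A))"
    using sum.Sigma[OF finY, of "\<lambda>D A. h (D, A)"] by (simp add: case_prod_unfold)
  finally show ?thesis by (simp add: h_def sum_distrib_left)
qed

text \<open>The first bound is Cauchy-Schwarz, with the square sum of the coefficients at most
  \<open>(3 * 3 + 1) * N / z\<close>, rounded up to the square 16. The second adds the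
  \<open>3 * N / z\<close> exceptional terms and the contribution
  \<open>N * \<delta> \<le> N / z\<close>.\<close>

lemma exceptional_sum_bounds:
  fixes u :: "nat \<Rightarrow> complex" and e :: "nat \<Rightarrow> real"
  assumes e: "\<And>n. n \<in> {1..N} \<Longrightarrow> \<bar>e n\<bar> \<le> of_bool (X n) + \<delta>"
    and X: "real (card {n\<in>{1..N}. X n}) \<le> 3 * (real N / z)"
    and \<delta>: "0 \<le> \<delta>" "\<delta> \<le> 1" "\<delta> \<le> 1 / z" and z: "0 < z"
  shows "norm (\<Sum>n\<in>{1..N}. u n * of_real (e n)) \<le> 4 * sqrt (real N * (\<Sum>n\<in>{1..N}. (norm (u n))\<^sup>2) / z)"
    and "(\<forall>n\<in>{1..N}. norm (u n) \<le> 1) \<Longrightarrow>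
      norm (\<Sum>n\<in>{1..N}. u n * of_real (e n)) \<le> 4 * (real N / z)"
proof -
  let ?S = "\<Sum>n\<in>{1..N}. (norm (u n))\<^sup>2"
  have cX: "(\<Sum>n\<in>{1..N}. of_bool (X n)) = real (card {n\<in>{1..N}. X n})"
    unfolding of_bool_def by (subst sum.inter_filter[symmetric]) auto
  have c\<delta>: "(\<Sum>n\<in>{1..N}. \<delta>) = real N * \<delta>" by simp
  have N\<delta>: "real N * \<delta> \<le> real N / z" using mult_left_mono[OF \<delta>(3), of "real N"] by simp
  have norm_le: "norm (\<Sum>n\<in>{1..N}. u n * of_real (e n)) \<le> (\<Sum>n\<in>{1..N}. norm (u n) * (of_bool (X n) + \<delta>))"
    by (rule sum_norm_le) (simp only: norm_mult norm_of_real, intro mult_left_mono e norm_ge_zero)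
  have "(of_bool (X n) + \<delta>)\<^sup>2 \<le> 3 * of_bool (X n) + \<delta>" for n
  proof -
    have "\<delta> * \<delta> \<le> \<delta>" using \<delta> by (simp add: mult_left_le)
    then show ?thesis using \<delta> by (cases "X n") (auto simp: power2_eq_square algebra_simps)
  qed
  then have "(\<Sum>n\<in>{1..N}. (of_bool (X n) + \<delta>)\<^sup>2) \<le> (\<Sum>n\<in>{1..N}. 3 * of_bool (X n) + \<delta>)"
    by (rule sum_mono)
  also have "\<dots> = 3 * real (card {n\<in>{1..N}. X n}) + real N * \<delta>"
    by (simp only: sum.distrib sum_distrib_left[symmetric] cX c\<delta>)
  also have "\<dots> \<le> 10 * (real N / z)" using X N\<delta> by linarith
  finally have sq: "(\<Sum>n\<in>{1..N}. (of_bool (X n) + \<delta>)\<^sup>2) \<le> 16 * (real N / z)"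
    using z by (smt (verit) divide_nonneg_pos of_nat_0_le_iff)
  have "(norm (\<Sum>n\<in>{1..N}. u n * of_real (e n)))\<^sup>2 \<le> (\<Sum>n\<in>{1..N}. norm (u n) * (of_bool (X n) + \<delta>))\<^sup>2"
    using norm_le by (intro power_mono) auto
  also have "\<dots> \<le> ?S * (\<Sum>n\<in>{1..N}. (of_bool (X n) + \<delta>)\<^sup>2)"
    by (rule Cauchy_Schwarz_ineq_sum)
  also have "\<dots> \<le> ?S * (16 * (real N / z))"
    by (intro mult_left_mono sq sum_nonneg) simp
  also have "\<dots> = 16 * (real N * ?S / z)" by simp
  finally have "norm (\<Sum>n\<in>{1..N}. u n * of_real (e n)) \<le> sqrt (16 * (real N * ?S / z))"
    by (rule real_le_rsqrt)
  also have "\<dots> = sqrt (4\<^sup>2) * sqrt (real N * ?S / z)"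
    unfolding real_sqrt_mult[symmetric] by simp
  finally show "norm (\<Sum>n\<in>{1..N}. u n * of_real (e n)) \<le> 4 * sqrt (real N * ?S / z)" by simp
  assume u: "\<forall>n\<in>{1..N}. norm (u n) \<le> 1"
  have "(\<Sum>n\<in>{1..N}. norm (u n) * (of_bool (X n) + \<delta>)) \<le> (\<Sum>n\<in>{1..N}. 1 * (of_bool (X n) + \<delta>))"
    using u \<delta> by (intro sum_mono mult_right_mono) auto
  also have "\<dots> = real (card {n\<in>{1..N}. X n}) + real N * \<delta>"
    by (simp only: sum.distrib mult_1_left cX c\<delta>)
  finally show "norm (\<Sum>n\<in>{1..N}. u n * of_real (e n)) \<le> 4 * (real N / z)"
    using norm_le X N\<delta> by linarith
qed

text \<open>From \<open>ln 2 \<ge> 2 / 3\<close> the left side is at most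
  \<open>12 * ln N + 8\<close>, and \<open>8 \<le> 4 * ln N\<close> holds because
  \<open>ln 16 = 4 * ln 2 \<ge> 2\<close>.\<close>

lemma bit_length_le_ln:
  assumes "16 \<le> N"
  shows "8 * real (floor_log N + 1) \<le> 16 * ln (real N)"
proof -
  have "2 ^ floor_log N \<le> N" using assms by (intro floor_log_exp2_le) simp
  then have "(2::real) ^ floor_log N \<le> real N" by (metis of_nat_le_iff of_nat_numeral of_nat_power)
  then have "ln ((2::real) ^ floor_log N) \<le> ln (real N)" using assms by simp
  then have "real (floor_log N) * ln 2 \<le> ln (real N)" by (simp add: ln_realpow)
  moreover have "real (floor_log N) * (2 / 3) \<le> real (floor_log N) * ln 2"
    by (intro mult_left_mono ln2_ge_two_thirds) simp
  moreover have "2 \<le> ln (real N)"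
  proof -
    have "4 * ln 2 = ln ((2::real) ^ 4)" by (subst ln_realpow) auto
    also have "\<dots> \<le> ln (real N)" using assms by simp
    finally show ?thesis using ln2_ge_two_thirds by linarith
  qed
  ultimately show ?thesis by simp
qed

section \<open>Each sum as a linear form in the values \<open>u n\<close>\<close>

lemma sum_over_products:
  fixes u :: "nat \<Rightarrow> complex" and h :: "nat \<Rightarrow> nat \<Rightarrow> real"
  assumes "finite X" "\<And>k l. (k, l) \<in> X \<Longrightarrow> k * l \<in> {1..N}"
  shows "(\<Sum>(k, l)\<in>X. of_real (h k l) * u (k * l)) =
     (\<Sum>n\<in>{1..N}. u n * of_real (\<Sum>(k, l)\<in>{x\<in>X. fst x * snd x = n}. h k l))"
proof -
  have "(\<Sum>(k, l)\<in>X. of_real (h k l) * u (k * l)) =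
    (\<Sum>n\<in>{1..N}. \<Sum>x\<in>{x\<in>X. fst x * snd x = n}. of_real (h (fst x) (snd x)) * u (fst x * snd x))"
    unfolding case_prod_unfold
    by (rule sum.group[symmetric]) (use assms in auto)
  also have "\<dots> = (\<Sum>n\<in>{1..N}. u n * of_real (\<Sum>(k, l)\<in>{x\<in>X. fst x * snd x = n}. h k l))"
    by (intro sum.cong refl) (auto simp: sum_distrib_left case_prod_unfold mult.commute intro!: sum.cong)
  finally show ?thesis .
qed

lemma type_I_sum_eq:
  fixes u :: "nat \<Rightarrow> complex"
  assumes "finite S"
  shows "(\<Sum>d\<in>S. of_int (c d) * (\<Sum>n\<in>{n\<in>{1..N}. d dvd n}. u n)) =
    (\<Sum>n\<in>{1..N}. u n * of_real (\<Sum>d\<in>{d\<in>S. d dvd n}. of_int (c d)))"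
proof -
  have "(\<Sum>d\<in>S. of_int (c d) * (\<Sum>n\<in>{n\<in>{1..N}. d dvd n}. u n)) =
      (\<Sum>d\<in>S. \<Sum>n\<in>{n\<in>{1..N}. d dvd n}. of_int (c d) * u n)"
    by (simp add: sum_distrib_left)
  also have "\<dots> = (\<Sum>n\<in>{1..N}. \<Sum>d\<in>{d\<in>S. d dvd n}. of_int (c d) * u n)"
    using assms by (intro sum.swap_restrict) auto
  also have "\<dots> = (\<Sum>n\<in>{1..N}. u n * of_real (\<Sum>d\<in>{d\<in>S. d dvd n}. of_int (c d)))"
    by (simp add: sum_distrib_left mult.commute)
  finally show ?thesis .
qed

lemma ramare_sum_eq:
  fixes u :: "nat \<Rightarrow> complex"
  assumes P: "\<And>p. p \<in> P \<Longrightarrow> prime p"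
  shows "(\<Sum>(m, p)\<in>{(m, p). 1 \<le> m \<and> p \<in> P \<and> z \<le> real p \<and> real p < Z \<and> m * p \<le> N}.
       of_real (r m) * u (m * p)) =
     (\<Sum>n\<in>{1..N}. u n * of_real (\<Sum>p\<in>{p\<in>P. z \<le> real p \<and> real p < Z \<and> p dvd n}. r (n div p)))"
proof -
  let ?X = "{(m, p). 1 \<le> m \<and> p \<in> P \<and> z \<le> real p \<and> real p < Z \<and> m * p \<le> N}"
  have pos: "0 < p" if "p \<in> P" for p using P[OF that] by (rule prime_gt_0_nat)
  have "?X \<subseteq> {..N} \<times> {..N}"
  proof clarify
    fix m p assume mp: "1 \<le> m" "p \<in> P" "m * p \<le> N"
    have "m \<le> m * p" "p \<le> m * p" using mp pos[OF mp(2)] by auto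
    from this[THEN order_trans, OF mp(3)] show "m \<in> {..N} \<and> p \<in> {..N}" by simp
  qed
  then have fin: "finite ?X" by (rule finite_subset) simp
  have "(\<Sum>(m, p)\<in>?X. of_real (r m) * u (m * p)) =
     (\<Sum>n\<in>{1..N}. u n * of_real (\<Sum>(m, p)\<in>{x\<in>?X. fst x * snd x = n}. r m))"
    by (rule sum_over_products[OF fin, where h = "\<lambda>m p. r m"]) (use pos in \<open>auto simp: Suc_le_eq\<close>)
  also have "\<dots> = (\<Sum>n\<in>{1..N}. u n * of_real (\<Sum>p\<in>{p\<in>P. z \<le> real p \<and> real p < Z \<and> p dvd n}. r (n div p)))"
  proof (intro sum.cong refl arg_cong[where f = "\<lambda>x. u n * of_real x" for n])
    fix n assume n: "n \<in> {1..N}"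
    show "(\<Sum>(m, p)\<in>{x\<in>?X. fst x * snd x = n}. r m) =
      (\<Sum>p\<in>{p\<in>P. z \<le> real p \<and> real p < Z \<and> p dvd n}. r (n div p))"
    proof (rule sum.reindex_bij_witness[where i = "\<lambda>p. (n div p, p)" and j = snd])
      fix p assume p: "p \<in> {p\<in>P. z \<le> real p \<and> real p < Z \<and> p dvd n}"
      then have "0 < n div p" using n pos[of p] by (auto simp: div_greater_zero_iff dvd_imp_le)
      then show "(n div p, p) \<in> {x\<in>?X. fst x * snd x = n}" using p n by auto
    qed (use pos in auto)
  qed
  finally show ?thesis .
qed

theorem theorem1p4:
  shows "\<exists>(C::real) (N0::nat).
    \<forall>(P::nat set) (\<kappa>::real) (N::nat) (z::real) (Z::real) (M0::real) (M::real).
      infinite P \<and> (\<forall>p\<in>P. prime p) \<and> 0 < \<kappa> \<and> \<kappa> \<le> 1 \<and> has_prime_density P \<kappa> \<and>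
      N0 \<le> N \<and> 0 < z \<and> max 2 z \<le> Z \<and> Z \<le> real N \<and> 2 \<le> M0 \<and> M0 \<le> M \<longrightarrow>
      (\<exists>(\<alpha>::nat \<Rightarrow> real \<Rightarrow> complex) (\<beta>::nat \<Rightarrow> real \<Rightarrow> complex).
        (\<forall>l\<ge>1. \<forall>t\<in>{0..1}. norm (\<alpha> l t) \<le> 1) \<and>
        (\<forall>k\<ge>1. \<forall>t\<in>{0..1}. norm (\<beta> k t) \<le> 16 * real (tau3 k) * ln (real N)) \<and>
        (\<forall>l\<ge>1. \<forall>t\<in>{0..1}. \<not> l dvd prime_product P z \<longrightarrow> \<alpha> l t = 0) \<and>
        (\<forall>u::nat \<Rightarrow> complex.
          (\<lambda>t. bilinear_sum N z M0 M (\<lambda>l. \<alpha> l t) (\<lambda>k. \<beta> k t) u) integrable_on {0..1} \<and>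
          (\<exists>E::complex.
            (\<Sum>n\<in>{n\<in>{1..N}. coprime n (prime_product P Z)}. u n) =
              (\<Sum>d\<in>{d. d dvd prime_product P z \<and> real d < M}.
                  of_int (moebius_mu d) * (\<Sum>n\<in>{n\<in>{1..N}. d dvd n}. u n))
              - (\<Sum>(m, p)\<in>{(m, p). 1 \<le> m \<and> p \<in> P \<and> z \<le> real p \<and> real p < Z \<and> m * p \<le> N}.
                  of_real (rho P z Z m) * u (m * p))
              - integral {0..1} (\<lambda>t. bilinear_sum N z M0 M (\<lambda>l. \<alpha> l t) (\<lambda>k. \<beta> k t) u)
              + E \<and>
            norm E \<le> C * sqrt (real N * (\<Sum>n\<in>{1..N}. (norm (u n))\<^sup>2) / z) \<and>
            ((\<forall>n\<in>{1..N}. norm (u n) \<le> 1) \<longrightarrow> norm E \<le> C * (real N / z)))))"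
proof (rule exI[of _ 4], rule exI[of _ 16], intro allI impI)
  \<comment> \<open>The constant 4 is that of \<open>exceptional_sum_bounds\<close>, and 16 is the
    size of \<open>N\<close> asked for by \<open>bit_length_le_ln\<close>.\<close>
  fix P :: "nat set" and \<kappa> :: real and N :: nat and z Z M0 M :: real
  assume H: "infinite P \<and> (\<forall>p\<in>P. prime p) \<and> 0 < \<kappa> \<and> \<kappa> \<le> 1 \<and> has_prime_density P \<kappa> \<and>
      16 \<le> N \<and> 0 < z \<and> max 2 z \<le> Z \<and> Z \<le> real N \<and> 2 \<le> M0 \<and> M0 \<le> M"
  then have P: "\<And>p. p \<in> P \<Longrightarrow> prime p" and N: "16 \<le> N" and z: "0 < z" "z \<le> Z" and M0: "2 \<le> M0" "M0 \<le> M"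
    by auto
  define Q where "Q = {p\<in>P. real p < z}"
  have Q: "finite Q" "\<And>p. p \<in> Q \<Longrightarrow> prime p" "\<And>p. p \<in> Q \<Longrightarrow> real p < z"
    unfolding Q_def using finite_primes_below P by auto
  have Pz: "prime_product P z = \<Prod>Q" by (simp add: prime_product_def Q_def)
  have finDiv: "finite {d. d dvd \<Prod>Q}" using prod_primes_pos[of Q] Q(2) by (intro finite_divisors_nat) auto
  \<comment> \<open>The total error allowed to the Riemann sums at one \<open>n\<close>. It is
    shared among at most \<open>N\<close> divisors, hence the accuracy \<open>\<delta> / N\<close>
    demanded of the kernel.\<close>
  define \<delta> where "\<delta> = min 1 (1 / z)"
  have \<delta>: "0 < \<delta>" "\<delta> \<le> 1" "\<delta> \<le> 1 / z" using z by (auto simp: \<delta>_def)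
  \<comment> \<open>\<open>I\<close> binary digits hold every divisor of every
    \<open>n \<le> N\<close>.\<close>
  define I where "I = floor_log N + 1"
  have I: "N < 2 ^ I" using floor_log_exp2_gt[of N] by (simp add: I_def)
  have cost: "8 * real I \<le> 16 * ln (real N)" "0 < 8 * real I"
    using bit_length_le_ln[OF N] by (auto simp: I_def)
  have eps: "0 < \<delta> / real N" using \<delta> N by simp
  obtain f where f: "separable (\<lambda>b. 2 ^ card {p\<in>Q. p dvd b}) (8 * real I) f"
    and f_supp: "\<And>A B. A \<subseteq> Q \<Longrightarrow> B \<subseteq> Q \<Longrightarrow> \<Prod>A < 2 ^ I \<Longrightarrow> f (\<Prod>A) (\<Prod>B) \<noteq> 0 \<Longrightarrow>
       A \<inter> B = {} \<and> M \<le> real (\<Prod>A * \<Prod>B) \<and> M0 \<le> real (\<Prod>A) \<and> (\<exists>p\<in>A. real (\<Prod>(A - {p})) < M0)"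
    and f_sum: "\<And>D. D \<subseteq> Q \<Longrightarrow> \<Prod>D < 2 ^ I \<Longrightarrow> M0 \<le> real (\<Prod>D) \<Longrightarrow> M \<le> real (\<Prod>D) \<Longrightarrow>
       \<bar>1 - (\<Sum>A\<in>Pow D. f (\<Prod>A) (\<Prod>(D - A)))\<bar> < \<delta> / real N"
    using separable_factorization_kernel[of Q M0 M "\<delta> / real N" I] Q M0 eps by (smt (verit))
  obtain a :: "real \<Rightarrow> nat \<Rightarrow> real" and c :: "real \<Rightarrow> nat \<Rightarrow> real"
    where a: "\<And>t l. \<bar>a t l\<bar> \<le> 1" and c: "\<And>t b. \<bar>c t b\<bar> \<le> 8 * real I * 2 ^ card {p\<in>Q. p dvd b}"
      and ac: "\<And>l b. ((\<lambda>t. a t l * c t b) has_integral f l b) {0..1}"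
    using separable_has_integral_unit[OF f] cost(2) by auto
  \<comment> \<open>A divisor \<open>d = l * b\<close> has
    \<open>\<mu>(d) = \<mu>(l) * \<mu>(b)\<close> for coprime \<open>l\<close> and \<open>b\<close>.
    The first factor goes here; the second goes into \<open>\<beta>\<close>, where \<open>b\<close>
    runs over divisors of the cofactor \<open>k\<close>. The minus sign in \<open>\<beta>\<close>
    appears because the integral is subtracted in the identity.\<close>
  define \<alpha> :: "nat \<Rightarrow> real \<Rightarrow> complex" where
    "\<alpha> l t = of_real (of_bool (l dvd \<Prod>Q) * (of_int (moebius_mu l) * a t l))" for l t
  define \<beta> :: "nat \<Rightarrow> real \<Rightarrow> complex" where
    "\<beta> k t = of_real (- (\<Sum>b\<in>{b. b dvd k \<and> b dvd \<Prod>Q}. of_int (moebius_mu b) * c t b))" for k t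
  have \<mu>: "\<bar>of_int (moebius_mu d)\<bar> \<le> (1::real)" for d
    using moebius_mu_abs_le[of d] by linarith
  have \<alpha>_le: "norm (\<alpha> l t) \<le> 1" for l t
    unfolding \<alpha>_def norm_of_real abs_mult
    using mult_mono[OF \<mu>[of l] a[of t l]] by (simp add: of_bool_def)
  have \<beta>_le: "norm (\<beta> k t) \<le> 16 * real (tau3 k) * ln (real N)" if k: "1 \<le> k" for k t
  proof -
    have fin: "finite {b. b dvd k}" using k by simp
    have "norm (\<beta> k t) \<le> (\<Sum>b\<in>{b. b dvd k \<and> b dvd \<Prod>Q}. \<bar>of_int (moebius_mu b) * c t b\<bar>)"
      unfolding \<beta>_def norm_of_real abs_minus_cancel by (rule sum_abs)
    also have "\<dots> \<le> (\<Sum>b\<in>{b. b dvd k \<and> b dvd \<Prod>Q}. 8 * real I * 2 ^ card {p\<in>Q. p dvd b})"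
    proof (rule sum_mono)
      fix b
      show "\<bar>of_int (moebius_mu b) * c t b\<bar> \<le> 8 * real I * 2 ^ card {p\<in>Q. p dvd b}"
        unfolding abs_mult using mult_mono[OF \<mu>[of b] c[of t b]] by simp
    qed
    also have "\<dots> \<le> (\<Sum>b\<in>{b. b dvd k}. 8 * real I * 2 ^ card {p\<in>Q. p dvd b})"
      using fin by (intro sum_mono2) auto
    also have "\<dots> = 8 * real I * real (\<Sum>b\<in>{b. b dvd k}. 2 ^ card {p\<in>Q. p dvd b})"
      by (simp add: sum_distrib_left)
    also have "\<dots> \<le> 8 * real I * real (tau3 k)"
      using sum_two_power_card_prime_factors_le_tau3[OF Q(1), of k] Q(2) k
      by (intro mult_left_mono) (auto simp del: of_nat_sum)
    also have "\<dots> \<le> 16 * ln (real N) * real (tau3 k)"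
      using cost by (intro mult_right_mono) auto
    finally show ?thesis by (simp add: mult_ac)
  qed
  define g where "g k l = - (\<Sum>b\<in>{b. b dvd k \<and> b dvd \<Prod>Q}.
     of_bool (l dvd \<Prod>Q) * (of_int (moebius_mu l) * of_int (moebius_mu b) * f l b))" for k l
  let ?X = "{(k, l). 1 \<le> k \<and> 1 \<le> l \<and> M \<le> real (k * l) \<and> k * l \<le> N \<and> M0 \<le> real l \<and> real l \<le> M0 * z}"
  have finX: "finite ?X"
  proof (rule finite_subset)
    have "k \<le> N \<and> l \<le> N" if "1 \<le> k" "1 \<le> l" "k * l \<le> N" for k l
    proof -
      have "k \<le> k * l" "l \<le> k * l" using that by auto
      then show ?thesis using that(3) by linarith
    qed
    then show "?X \<subseteq> {..N} \<times> {..N}" by auto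
  qed simp
  have \<alpha>\<beta>: "((\<lambda>t. \<alpha> l t * \<beta> k t) has_integral of_real (g k l)) {0..1}" for k l
  proof -
    have "((\<lambda>t. - (\<Sum>b\<in>{b. b dvd k \<and> b dvd \<Prod>Q}. of_bool (l dvd \<Prod>Q) *
        (of_int (moebius_mu l) * of_int (moebius_mu b)) * (a t l * c t b))) has_integral
      - (\<Sum>b\<in>{b. b dvd k \<and> b dvd \<Prod>Q}. of_bool (l dvd \<Prod>Q) *
        (of_int (moebius_mu l) * of_int (moebius_mu b)) * f l b)) {0..1}"
      by (intro has_integral_neg has_integral_sum has_integral_mult_right ac finite_subset[OF _ finDiv]) auto
    from has_integral_of_real[OF this]
    show ?thesis
      by (simp add: \<alpha>_def \<beta>_def g_def sum_distrib_left mult_ac)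
  qed
  have coeff: "(\<Sum>(k, l)\<in>{x\<in>?X. fst x * snd x = n}. g k l) =
     - (\<Sum>D\<in>{D\<in>Pow Q. \<Prod>D dvd n \<and> M \<le> real (\<Prod>D)}. of_int (moebius_mu (\<Prod>D)) *
        (\<Sum>A\<in>Pow D. f (\<Prod>A) (\<Prod>(D - A))))" if n: "n \<in> {1..N}" for n
  proof -
    have "{x\<in>?X. fst x * snd x = n} = {(k, l). 1 \<le> k \<and> 1 \<le> l \<and> M \<le> real (k * l) \<and> k * l = n \<and>
        M0 \<le> real l \<and> real l \<le> M0 * z}"
      using n by auto
    moreover have "(\<Sum>(k, l)\<in>\<dots>. \<Sum>b\<in>{b. b dvd k \<and> b dvd \<Prod>Q}.
       of_bool (l dvd \<Prod>Q) * (of_int (moebius_mu l) * of_int (moebius_mu b) * f l b)) =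
      (\<Sum>D\<in>{D\<in>Pow Q. \<Prod>D dvd n \<and> M \<le> real (\<Prod>D)}. of_int (moebius_mu (\<Prod>D)) *
        (\<Sum>A\<in>Pow D. f (\<Prod>A) (\<Prod>(D - A))))"
    proof (rule sum_bilinear_coefficients[OF Q])
      fix A B assume "A \<subseteq> Q" "B \<subseteq> Q" "\<Prod>A \<le> n" "f (\<Prod>A) (\<Prod>B) \<noteq> 0"
      moreover have "\<Prod>A < 2 ^ I" using \<open>\<Prod>A \<le> n\<close> n I by simp
      ultimately show "A \<inter> B = {} \<and> M \<le> real (\<Prod>A * \<Prod>B) \<and> M0 \<le> real (\<Prod>A) \<and> (\<exists>p\<in>A. real (\<Prod>(A - {p})) < M0)"
        by (intro f_supp)
    qed (use n in auto)
    ultimately show ?thesis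
      by (simp only: g_def case_prod_unfold sum_negf)
  qed
  define low where "low n = (\<Sum>d\<in>{d\<in>{d. d dvd \<Prod>Q \<and> real d < M}. d dvd n}. of_int (moebius_mu d) :: real)" for n
  define W where "W n = (\<Sum>p\<in>{p\<in>P. z \<le> real p \<and> real p < Z \<and> p dvd n}. rho P z Z (n div p))" for n
  define V where "V n = (\<Sum>(k, l)\<in>{x\<in>?X. fst x * snd x = n}. g k l)" for n
  \<comment> \<open>The coefficient of \<open>u n\<close> in the error. Inserting the indicator of
    coprimality to \<open>P(z)\<close> splits it into the defect of Ramare's identity and the defect
    of the kernel.\<close>
  define e where "e n = of_bool (coprime n (prime_product P Z)) - low n + W n + V n" for n
  \<comment> \<open>Moebius inversion leaves the divisors \<open>\<Prod>D \<ge> M\<close>. The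
    kernel reproduces each of them with total mass close to 1, so only the small factors
    \<open>1 - (\<Sum>A\<in>Pow D. f (\<Prod>A) (\<Prod>(D - A)))\<close> remain.\<close>
  have high: "\<bar>of_bool (coprime n (\<Prod>Q)) - low n + V n\<bar> \<le> \<delta>" if n: "n \<in> {1..N}" for n
  proof -
    let ?Y = "{D\<in>Pow Q. \<Prod>D dvd n \<and> M \<le> real (\<Prod>D)}"
    have fin: "finite {d. d dvd \<Prod>Q \<and> d dvd n}" by (rule finite_subset[OF _ finDiv]) auto
    have inj: "inj_on Prod ?Y"
      using inj_on_prod_primes[OF Q(1,2)] by (rule inj_on_subset) auto
    have "Prod ` ?Y = {d \<in> Prod ` Pow Q. d dvd n \<and> M \<le> real d}" by blast
    then have img: "Prod ` ?Y = {d. d dvd \<Prod>Q \<and> d dvd n \<and> M \<le> real d}"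
      using divisors_prod_primes[of Q] Q(1,2) by blast
    have "of_bool (coprime n (\<Prod>Q)) = (\<Sum>d\<in>{d. d dvd \<Prod>Q \<and> d dvd n}. of_int (moebius_mu d) :: real)"
    proof -
      have "(\<Sum>d\<in>{d. d dvd \<Prod>Q \<and> d dvd n}. moebius_mu d) = of_bool (coprime n (\<Prod>Q))"
        by (rule sum_moebius_mu_eq_coprime) (use Q in auto)
      from arg_cong[OF this, of "of_int :: int \<Rightarrow> real"] show ?thesis by simp
    qed
    also have "\<dots> = low n + (\<Sum>d\<in>{d. d dvd \<Prod>Q \<and> d dvd n \<and> M \<le> real d}. of_int (moebius_mu d))"
      unfolding low_def using fin
      by (subst sum.union_disjoint[symmetric]) (auto intro!: sum.cong elim: finite_subset[rotated])
    also have "(\<Sum>d\<in>{d. d dvd \<Prod>Q \<and> d dvd n \<and> M \<le> real d}. of_int (moebius_mu d) :: real) =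
       (\<Sum>D\<in>?Y. of_int (moebius_mu (\<Prod>D)))"
      unfolding img[symmetric] by (subst sum.reindex[OF inj]) simp
    finally have "of_bool (coprime n (\<Prod>Q)) - low n + V n =
       (\<Sum>D\<in>?Y. of_int (moebius_mu (\<Prod>D)) * (1 - (\<Sum>A\<in>Pow D. f (\<Prod>A) (\<Prod>(D - A)))))"
      unfolding V_def coeff[OF n] by (simp add: sum_subtractf right_diff_distrib)
    also have "\<bar>\<dots>\<bar> \<le> (\<Sum>D\<in>?Y. \<delta> / real N)"
    proof (rule order_trans[OF sum_abs sum_mono])
      fix D assume D: "D \<in> ?Y"
      then have "\<Prod>D \<le> n" using n by (auto intro: dvd_imp_le)
      then have "\<bar>1 - (\<Sum>A\<in>Pow D. f (\<Prod>A) (\<Prod>(D - A)))\<bar> < \<delta> / real N"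
        using D n I M0 by (intro f_sum) auto
      then show "\<bar>of_int (moebius_mu (\<Prod>D)) * (1 - (\<Sum>A\<in>Pow D. f (\<Prod>A) (\<Prod>(D - A))))\<bar> \<le> \<delta> / real N"
        unfolding abs_mult using mult_mono[OF \<mu>[of "\<Prod>D"] less_imp_le] by fastforce
    qed
    also have "\<dots> = real (card ?Y) * (\<delta> / real N)" by simp
    \<comment> \<open>Distinct sets \<open>D\<close> give distinct divisors of \<open>n\<close>, so
      there are at most \<open>N\<close> of them.\<close>
    also have "\<dots> \<le> real N * (\<delta> / real N)"
    proof (intro mult_right_mono)
      have "card ?Y = card (Prod ` ?Y)" using card_image[OF inj] by simp
      also have "\<dots> \<le> card {1..N}"
      proof (rule card_mono)
        show "Prod ` ?Y \<subseteq> {1..N}"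
        proof
          fix d assume "d \<in> Prod ` ?Y"
          then have "d dvd n" by auto
          then have "0 < d" "d \<le> n" using n by (auto intro: dvd_imp_le Nat.gr0I)
          then show "d \<in> {1..N}" using n by simp
        qed
      qed simp
      finally show "real (card ?Y) \<le> real N" by simp
    qed (use eps in simp)
    also have "\<dots> = \<delta>" using N by simp
    finally show ?thesis .
  qed
  have e_le: "\<bar>e n\<bar> \<le> of_bool (ramare_exceptional P z Z n) + \<delta>" if n: "n \<in> {1..N}" for n
  proof -
    have "\<bar>of_bool (coprime n (prime_product P Z)) - of_bool (coprime n (prime_product P z)) + W n\<bar>
        \<le> of_bool (ramare_exceptional P z Z n)"
      unfolding W_def by (rule ramare_weights) (use P z n in auto)
    with high[OF n] show ?thesis unfolding e_def Pz by linarith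
  qed
  have exc: "real (card {n\<in>{1..N}. ramare_exceptional P z Z n}) \<le> 3 * (real N / z)"
    by (rule card_ramare_exceptional_le) (use P z in auto)
  show "\<exists>(\<alpha>::nat \<Rightarrow> real \<Rightarrow> complex) (\<beta>::nat \<Rightarrow> real \<Rightarrow> complex).
        (\<forall>l\<ge>1. \<forall>t\<in>{0..1}. norm (\<alpha> l t) \<le> 1) \<and>
        (\<forall>k\<ge>1. \<forall>t\<in>{0..1}. norm (\<beta> k t) \<le> 16 * real (tau3 k) * ln (real N)) \<and>
        (\<forall>l\<ge>1. \<forall>t\<in>{0..1}. \<not> l dvd prime_product P z \<longrightarrow> \<alpha> l t = 0) \<and>
        (\<forall>u::nat \<Rightarrow> complex.
          (\<lambda>t. bilinear_sum N z M0 M (\<lambda>l. \<alpha> l t) (\<lambda>k. \<beta> k t) u) integrable_on {0..1} \<and>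
          (\<exists>E::complex.
            (\<Sum>n\<in>{n\<in>{1..N}. coprime n (prime_product P Z)}. u n) =
              (\<Sum>d\<in>{d. d dvd prime_product P z \<and> real d < M}.
                  of_int (moebius_mu d) * (\<Sum>n\<in>{n\<in>{1..N}. d dvd n}. u n))
              - (\<Sum>(m, p)\<in>{(m, p). 1 \<le> m \<and> p \<in> P \<and> z \<le> real p \<and> real p < Z \<and> m * p \<le> N}.
                  of_real (rho P z Z m) * u (m * p))
              - integral {0..1} (\<lambda>t. bilinear_sum N z M0 M (\<lambda>l. \<alpha> l t) (\<lambda>k. \<beta> k t) u)
              + E \<and>
            norm E \<le> 4 * sqrt (real N * (\<Sum>n\<in>{1..N}. (norm (u n))\<^sup>2) / z) \<and>
            ((\<forall>n\<in>{1..N}. norm (u n) \<le> 1) \<longrightarrow> norm E \<le> 4 * (real N / z))))"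
  proof (rule exI[of _ \<alpha>], rule exI[of _ \<beta>], intro conjI allI impI ballI)
    fix u :: "nat \<Rightarrow> complex"
    define E where "E = (\<Sum>n\<in>{1..N}. u n * of_real (e n))"
    have int: "((\<lambda>t. bilinear_sum N z M0 M (\<lambda>l. \<alpha> l t) (\<lambda>k. \<beta> k t) u) has_integral
       (\<Sum>(k, l)\<in>?X. of_real (g k l) * u (k * l))) {0..1}"
    proof -
      have "((\<lambda>t. \<Sum>x\<in>?X. \<alpha> (snd x) t * \<beta> (fst x) t * u (fst x * snd x)) has_integral
         (\<Sum>x\<in>?X. of_real (g (fst x) (snd x)) * u (fst x * snd x))) {0..1}"
        by (rule has_integral_sum[OF finX]) (rule has_integral_mult_left[OF \<alpha>\<beta>])
      then show ?thesis by (simp only: bilinear_sum_def case_prod_unfold)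
    qed
    then show "(\<lambda>t. bilinear_sum N z M0 M (\<lambda>l. \<alpha> l t) (\<lambda>k. \<beta> k t) u) integrable_on {0..1}"
      by blast
    have bil: "(\<Sum>(k, l)\<in>?X. of_real (g k l) * u (k * l)) = (\<Sum>n\<in>{1..N}. u n * of_real (V n))"
      unfolding V_def by (rule sum_over_products[OF finX]) auto
    have sieve: "(\<Sum>n\<in>{n\<in>{1..N}. coprime n (prime_product P Z)}. u n) =
       (\<Sum>n\<in>{1..N}. u n * of_real (of_bool (coprime n (prime_product P Z))))"
      by (subst sum.inter_filter) (auto intro!: sum.cong)
    have type_I: "(\<Sum>d\<in>{d. d dvd prime_product P z \<and> real d < M}.
        of_int (moebius_mu d) * (\<Sum>n\<in>{n\<in>{1..N}. d dvd n}. u n)) = (\<Sum>n\<in>{1..N}. u n * of_real (low n))"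
      unfolding Pz low_def by (rule type_I_sum_eq) (rule finite_subset[OF _ finDiv], auto)
    have ram: "(\<Sum>(m, p)\<in>{(m, p). 1 \<le> m \<and> p \<in> P \<and> z \<le> real p \<and> real p < Z \<and> m * p \<le> N}.
        of_real (rho P z Z m) * u (m * p)) = (\<Sum>n\<in>{1..N}. u n * of_real (W n))"
      unfolding W_def by (rule ramare_sum_eq) (use P in auto)
    have "E = (\<Sum>n\<in>{1..N}. u n * of_real (of_bool (coprime n (prime_product P Z))))
       - (\<Sum>n\<in>{1..N}. u n * of_real (low n)) + (\<Sum>n\<in>{1..N}. u n * of_real (W n))
       + (\<Sum>n\<in>{1..N}. u n * of_real (V n))"
      unfolding E_def e_def of_real_add of_real_diff
      by (simp only: distrib_left right_diff_distrib sum.distrib sum_subtractf)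
    then have "(\<Sum>n\<in>{n\<in>{1..N}. coprime n (prime_product P Z)}. u n) =
              (\<Sum>d\<in>{d. d dvd prime_product P z \<and> real d < M}.
                  of_int (moebius_mu d) * (\<Sum>n\<in>{n\<in>{1..N}. d dvd n}. u n))
              - (\<Sum>(m, p)\<in>{(m, p). 1 \<le> m \<and> p \<in> P \<and> z \<le> real p \<and> real p < Z \<and> m * p \<le> N}.
                  of_real (rho P z Z m) * u (m * p))
              - integral {0..1} (\<lambda>t. bilinear_sum N z M0 M (\<lambda>l. \<alpha> l t) (\<lambda>k. \<beta> k t) u)
              + E"
      unfolding integral_unique[OF int] bil sieve type_I ram by simp
    moreover have "norm E \<le> 4 * sqrt (real N * (\<Sum>n\<in>{1..N}. (norm (u n))\<^sup>2) / z)"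
      "(\<forall>n\<in>{1..N}. norm (u n) \<le> 1) \<longrightarrow> norm E \<le> 4 * (real N / z)"
      unfolding E_def using exceptional_sum_bounds[OF e_le exc less_imp_le[OF \<delta>(1)] \<delta>(2,3) z(1)] by auto
    ultimately show "\<exists>E. (\<Sum>n\<in>{n\<in>{1..N}. coprime n (prime_product P Z)}. u n) =
              (\<Sum>d\<in>{d. d dvd prime_product P z \<and> real d < M}.
                  of_int (moebius_mu d) * (\<Sum>n\<in>{n\<in>{1..N}. d dvd n}. u n))
              - (\<Sum>(m, p)\<in>{(m, p). 1 \<le> m \<and> p \<in> P \<and> z \<le> real p \<and> real p < Z \<and> m * p \<le> N}.
                  of_real (rho P z Z m) * u (m * p))
              - integral {0..1} (\<lambda>t. bilinear_sum N z M0 M (\<lambda>l. \<alpha> l t) (\<lambda>k. \<beta> k t) u)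
              + E \<and>
            norm E \<le> 4 * sqrt (real N * (\<Sum>n\<in>{1..N}. (norm (u n))\<^sup>2) / z) \<and>
            ((\<forall>n\<in>{1..N}. norm (u n) \<le> 1) \<longrightarrow> norm E \<le> 4 * (real N / z))"
      by blast
  qed (use \<alpha>_le \<beta>_le in \<open>auto simp: \<alpha>_def Pz\<close>)
qed

end
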